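(* Let $\omega\in\mathbb R\setminus\{0\}$, $v\in\mathbb C\setminus\{0\}$, $$H_0=\begin{pmatrix}-\omega&0&0\\0&0&0\\0&0&\omega\end{pmatrix},\qquad V=\begin{pmatrix}0&v&0\\ \overline{v}&0&v\\0&\overline{v}&0\end{pmatrix}$$ (the uncontrollable harmonic $\Xi$ system with $v_{12}=v_{23}=v$ and $\mathrm{Tr}H_0=0$). Let $\lambda_1>\lambda_3>\lambda_2$ be real, $O=\mathrm{diag}(\lambda_1,\lambda_2,\lambda_3)$, $\rho_0=\mathrm{diag}(0,0,1)$. For $T>0$ let $J_O\colon L_2([0,T],\mathbb R)\to\mathbb R$, $J_O(f)=\mathrm{Tr}[U_T^f\rho_0(U_T^f)^\dagger O]$. Let $\mathcal R$ be the closed connected Lie subgroup of $\operatorname{SU}(3)$ whose Lie algebra is the Lie algebra generated by $iH_0$ and $iV$, and let $T_0>0$ be such that for every $T\ge T_0$ one has $\{U_T^f : f\in L_2([0,T],\mathbb R)\}=\mathcal R$. Then for every $T\ge T_0$, a control $f\in L_2([0,T],\mathbb R)$ is a trap for $J_O$ if and only if $U_T^f\in\mathcal R_Z$, where $\mathcal R_Z=\{\mathrm{diag}(e^{-i\phi},1,e^{i\phi}) : \phi\in[-\pi,\pi)\}$. In particular, $f_0\equiv0$ is a trap for $J_O$.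
   Context: For $f\in L_2([0,T],\mathbb R)$, $U_t^f$ denotes the unique absolutely continuous solution on $[0,T]$ of $i\,\frac{dU_t^f}{dt}=(H_0+f(t)V)U_t^f$, $U_0^f=\mathbb I$. A control $f\in L_2([0,T],\mathbb R)$ is a (true) trap for $J_O$ if $f$ is a point of local maximum of $J_O$ but not a point of global maximum of $J_O$. The Lie algebra generated by $iH_0$ and $iV$ is isomorphic to $\mathfrak{su}(2)$ (spin-1 representation), and a $T_0$ with the stated property exists. With $J_z=\mathrm{diag}(1,0,-1)$ one has $\mathcal R_Z=\{e^{-i\phi J_z}:\phi\in[-\pi,\pi)\}\subset\mathcal R$. *)

theory Defs
  imports "HOL-Analysis.Analysis" "HOL-Algebra.Group"
begin

subsection \<open>Controls\<close>

text \<open>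
  Controls are represented by functions rather than by classes modulo almost everywhere equality,
  and their values outside \<open>[0,T]\<close> are irrelevant. Thus \<open>L2_norm\<close> is a seminorm, and
  neighbourhoods are taken with respect to it.
\<close>

definition L2_controls :: "real \<Rightarrow> (real \<Rightarrow> real) set" where
  "L2_controls T = {f. f \<in> borel_measurable (lebesgue_on {0..T}) \<and>
     integrable (lebesgue_on {0..T}) (\<lambda>t. (f t)\<^sup>2)}"

definition L2_norm :: "real \<Rightarrow> (real \<Rightarrow> real) \<Rightarrow> real" where
  "L2_norm T f = sqrt (integral\<^sup>L (lebesgue_on {0..T}) (\<lambda>t. (f t)\<^sup>2))"

definition local_max :: "real \<Rightarrow> ((real \<Rightarrow> real) \<Rightarrow> real) \<Rightarrow> (real \<Rightarrow> real) \<Rightarrow> bool" where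
  "local_max T J f \<longleftrightarrow> f \<in> L2_controls T \<and>
     (\<exists>\<epsilon>>0. \<forall>g \<in> L2_controls T. L2_norm T (\<lambda>t. g t - f t) < \<epsilon> \<longrightarrow> J g \<le> J f)"

definition global_max :: "real \<Rightarrow> ((real \<Rightarrow> real) \<Rightarrow> real) \<Rightarrow> (real \<Rightarrow> real) \<Rightarrow> bool" where
  "global_max T J f \<longleftrightarrow> f \<in> L2_controls T \<and> (\<forall>g \<in> L2_controls T. J g \<le> J f)"

definition trap :: "real \<Rightarrow> ((real \<Rightarrow> real) \<Rightarrow> real) \<Rightarrow> (real \<Rightarrow> real) \<Rightarrow> bool" where
  "trap T J f \<longleftrightarrow> local_max T J f \<and> \<not> global_max T J f"


subsection \<open>Matrix Lie groups and Lie algebras\<close>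

definition ctranspose :: "complex^'n^'m \<Rightarrow> complex^'m^'n" where
  "ctranspose A = map_matrix cnj (transpose A)"

definition SU :: "(complex^'n^'n) monoid" where
  "SU = \<lparr>carrier = {U. ctranspose U ** U = mat 1 \<and> det U = 1}, mult = (**), one = mat 1\<rparr>"

definition mat_exp :: "complex^'n^'n \<Rightarrow> complex^'n^'n" where
  "mat_exp A = (\<Sum>k. (1 / fact k) *\<^sub>R (((\<lambda>B. A ** B) ^^ k) (mat 1)))"

text \<open>
  A closed subgroup of a Lie group is automatically a Lie subgroup; its Lie algebra consists of
  the generators of the one-parameter subgroups that it contains.
\<close>

definition lie_algebra_of :: "(complex^'n^'n) set \<Rightarrow> (complex^'n^'n) set" where
  "lie_algebra_of G = {X. \<forall>t::real. mat_exp (t *\<^sub>R X) \<in> G}"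

definition lie_subalgebra :: "(complex^'n^'n) set \<Rightarrow> bool" where
  "lie_subalgebra L \<longleftrightarrow> subspace L \<and> (\<forall>X\<in>L. \<forall>Y\<in>L. X ** Y - Y ** X \<in> L)"

definition lie_generated :: "(complex^'n^'n) set \<Rightarrow> (complex^'n^'n) set" where
  "lie_generated S = lie_subalgebra hull S"


subsection \<open>Controlled Schroedinger evolution\<close>

text \<open>
  A division is a finite family of nonempty compact intervals with disjoint interiors, so the
  following is the usual \<open>\<epsilon>\<close>-\<open>\<delta>\<close> notion of absolute continuity.
\<close>

definition abs_cont_on :: "real set \<Rightarrow> (real \<Rightarrow> 'a::real_normed_vector) \<Rightarrow> bool" where
  "abs_cont_on S U \<longleftrightarrow> (\<forall>\<epsilon>>0. \<exists>\<delta>>0. \<forall>D A. D division_of A \<and> A \<subseteq> S \<and> (\<Sum>k\<in>D. Sup k - Inf k) < \<delta> \<longrightarrow>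
     (\<Sum>k\<in>D. norm (U (Sup k) - U (Inf k))) < \<epsilon>)"

text \<open>Multiplication of a matrix by a complex scalar \<open>c\<close> is written \<open>mat c ** A\<close> throughout.\<close>

definition is_evolution ::
    "complex^'n^'n \<Rightarrow> complex^'n^'n \<Rightarrow> real \<Rightarrow> (real \<Rightarrow> real) \<Rightarrow> (real \<Rightarrow> complex^'n^'n) \<Rightarrow> bool" where
  "is_evolution H0 V T f U \<longleftrightarrow> abs_cont_on {0..T} U \<and> U 0 = mat 1 \<and>
     (AE t in lebesgue_on {0..T}. \<exists>D. (U has_vector_derivative D) (at t within {0..T}) \<and>
        mat \<i> ** D = (H0 + f t *\<^sub>R V) ** U t)"

text \<open>
  For \<open>f \<in> L2_controls T\<close> the solution is unique on \<open>[0,T]\<close>, but not as a function on the whole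
  real line; therefore the definite description is applied to its value at \<open>t\<close>.
\<close>

definition evolution ::
    "complex^'n^'n \<Rightarrow> complex^'n^'n \<Rightarrow> real \<Rightarrow> (real \<Rightarrow> real) \<Rightarrow> real \<Rightarrow> complex^'n^'n" where
  "evolution H0 V T f t = (THE X. \<exists>U. is_evolution H0 V T f U \<and> U t = X)"

text \<open>
  The trace is real for Hermitian \<open>\<rho>\<close> and \<open>O\<close>; \<open>Re\<close> only adjusts the type.
\<close>

definition objective ::
    "complex^'n^'n \<Rightarrow> complex^'n^'n \<Rightarrow> complex^'n^'n \<Rightarrow> complex^'n^'n \<Rightarrow> real \<Rightarrow> (real \<Rightarrow> real) \<Rightarrow> real"
  where
  "objective H0 V \<rho> Obs T f =
     Re (trace (evolution H0 V T f T ** \<rho> ** ctranspose (evolution H0 V T f T) ** Obs))"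


subsection \<open>The harmonic \<open>\<Xi>\<close> system\<close>

definition diag3 :: "complex \<Rightarrow> complex \<Rightarrow> complex \<Rightarrow> complex^3^3" where
  "diag3 a b c = vector [vector [a, 0, 0], vector [0, b, 0], vector [0, 0, c]]"

definition Xi_H0 :: "real \<Rightarrow> complex^3^3" where
  "Xi_H0 \<omega> = diag3 (- of_real \<omega>) 0 (of_real \<omega>)"

definition Xi_V :: "complex \<Rightarrow> complex^3^3" where
  "Xi_V v = vector [vector [0, v, 0], vector [cnj v, 0, v], vector [0, cnj v, 0]]"

definition R_Z :: "(complex^3^3) set" where
  "R_Z = {diag3 (exp (- \<i> * of_real \<phi>)) 1 (exp (\<i> * of_real \<phi>)) | \<phi>. \<phi> \<in> {-pi..<pi}}"

end

(*
For a solution U, the third column of U(T) satisfies psi_2^2 = 2 psi_1 psi_3, because the spin-1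
dynamics preserves a symmetric bilinear form. Hence, with x = |psi_3|, the populations are
(1-x)^2, 2x(1-x), x^2, and the objective is a strictly convex quadratic in x in [0,1] with global
maximum at x = 0 and a further endpoint local maximum at x = 1; the condition x = 1 characterises
R_Z. Controls with x = 1 are traps since the endpoint map is continuous in the control and x = 0
is attained by exp(i t V). For 0 < x < 1 the survival probability x^2 has a nonzero first variation
in the control, and by convexity the objective increases to one of the two sides.
*)
theory Submission
  imports Defs
begin

subsection \<open>Absolutely continuous functions\<close>

text \<open>Controls are only square integrable, so a solution satisfies its equation merely almost
  everywhere. Every property of solutions is therefore drawn from one pattern: a bilinear expression
  in absolutely continuous functions is the integral of its almost everywhere derivative. Applied to
  U^dagger W for two controls this gives unitarity, uniqueness, Lipschitz dependence on the control
  and the first variation; applied to U^dagger X U it gives the Heisenberg equation; applied to U^T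
  S U it gives the invariant form S. The delicate point of the landscape is an interior x at which
  the quadratic itself has slope zero. No second variation of the endpoint is computed there: once x
  can be moved to first order, strict convexity makes every displacement an increase. That x can be
  moved is where \<open>\<omega>\<close> and \<open>v\<close> being nonzero enter: they make V and
  [H0,V] independent enough to detect a complex number by its two real parts. The group R supplies
  determinant one, which fixes the middle entry of a diagonal endpoint, and it contains an element
  that sends x to 0.\<close>

lemma abs_cont_on_subset: "abs_cont_on S U \<Longrightarrow> S' \<subseteq> S \<Longrightarrow> abs_cont_on S' U"
  unfolding abs_cont_on_def by (meson order_trans)

lemma abs_cont_on_imp_continuous_on:
  assumes "abs_cont_on {a..b} U"
  shows "continuous_on {a..b} U"
  unfolding continuous_on_iff
proof (intro ballI allI impI)
  fix x e :: real assume x: "x \<in> {a..b}" and e: "e > 0"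
  obtain d where d: "d > 0"
    "\<And>D A. D division_of A \<Longrightarrow> A \<subseteq> {a..b} \<Longrightarrow> (\<Sum>k\<in>D. Sup k - Inf k) < d \<Longrightarrow>
      (\<Sum>k\<in>D. norm (U (Sup k) - U (Inf k))) < e"
    using assms e unfolding abs_cont_on_def by meson
  have "dist (U y) (U x) < e" if y: "y \<in> {a..b}" "dist y x < d" for y
  proof -
    have *: "norm (U v - U u) < e" if "u \<le> v" "u \<in> {a..b}" "v \<in> {a..b}" "v - u < d" for u v
      using d(2)[of "{{u..v}}" "{u..v}"] that division_of_self[of u v] by auto
    show ?thesis
      using *[of x y] *[of y x] x y
      by (cases "x \<le> y") (auto simp: dist_norm norm_minus_commute dist_real_def)
  qed
  then show "\<exists>d>0. \<forall>y\<in>{a..b}. dist y x < d \<longrightarrow> dist (U y) (U x) < e"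
    using d(1) by blast
qed

text \<open>The increment splits as h(dU, W) + h(U, dW). Both factors are bounded, being continuous
  on a compact interval, so the two variations are controlled separately, each with budget e/2. This
  is what makes products of two solutions accessible to the fundamental theorem of calculus.\<close>

lemma abs_cont_on_bilinear:
  assumes h: "bounded_bilinear h" and u: "abs_cont_on {a..b} U" and w: "abs_cont_on {a..b} W"
  shows "abs_cont_on {a..b} (\<lambda>t. h (U t) (W t))"
proof -
  interpret h: bounded_bilinear h by fact
  obtain K where K: "K > 0" "\<And>x y. norm (h x y) \<le> norm x * norm y * K"
    using h.pos_bounded by blast
  have "bounded (U ` {a..b})" "bounded (W ` {a..b})"
    using abs_cont_on_imp_continuous_on[OF u] abs_cont_on_imp_continuous_on[OF w]
    by (simp_all add: compact_imp_bounded compact_continuous_image)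
  then obtain B1 B2 where B: "B1 > 0" "\<And>t. t \<in> {a..b} \<Longrightarrow> norm (U t) \<le> B1"
     "B2 > 0" "\<And>t. t \<in> {a..b} \<Longrightarrow> norm (W t) \<le> B2"
    unfolding bounded_pos by fast
  show ?thesis
    unfolding abs_cont_on_def
  proof (intro allI impI)
    fix e :: real assume e: "e > 0"
    have e1: "e / (2 * K * B1) > 0" and e2: "e / (2 * K * B2) > 0" using e K B by auto
    obtain d1 where d1: "d1 > 0" "\<And>D A. D division_of A \<Longrightarrow> A \<subseteq> {a..b} \<Longrightarrow> (\<Sum>k\<in>D. Sup k - Inf k) < d1 \<Longrightarrow>
      (\<Sum>k\<in>D. norm (U (Sup k) - U (Inf k))) < e / (2 * K * B2)"
      using u e2 unfolding abs_cont_on_def by meson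
    obtain d2 where d2: "d2 > 0" "\<And>D A. D division_of A \<Longrightarrow> A \<subseteq> {a..b} \<Longrightarrow> (\<Sum>k\<in>D. Sup k - Inf k) < d2 \<Longrightarrow>
      (\<Sum>k\<in>D. norm (W (Sup k) - W (Inf k))) < e / (2 * K * B1)"
      using w e1 unfolding abs_cont_on_def by meson
    have "(\<Sum>k\<in>D. norm (h (U (Sup k)) (W (Sup k)) - h (U (Inf k)) (W (Inf k)))) < e"
      if D: "D division_of A" "A \<subseteq> {a..b}" "(\<Sum>k\<in>D. Sup k - Inf k) < min d1 d2" for D A
    proof -
      have "(\<Sum>k\<in>D. norm (h (U (Sup k)) (W (Sup k)) - h (U (Inf k)) (W (Inf k))))
         \<le> (\<Sum>k\<in>D. K * B2 * norm (U (Sup k) - U (Inf k)) + K * B1 * norm (W (Sup k) - W (Inf k)))"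
      proof (rule sum_mono)
        fix k assume k: "k \<in> D"
        obtain u v where uv: "k = {u..v}" "k \<noteq> {}"
          using division_ofD[OF D(1)] k by (metis box_real(2))
        then have "u \<le> v" "u \<in> {a..b}" "v \<in> {a..b}"
          using subset_trans[OF division_ofD(2)[OF D(1) k] D(2)] by auto
        have "h (U v) (W v) - h (U u) (W u) = h (U v - U u) (W v) + h (U u) (W v - W u)"
          by (simp add: h.diff_left h.diff_right)
        then have "norm (h (U v) (W v) - h (U u) (W u))
            \<le> norm (U v - U u) * norm (W v) * K + norm (U u) * norm (W v - W u) * K"
          by (metis K(2) norm_triangle_mono)
        also have "\<dots> \<le> norm (U v - U u) * B2 * K + B1 * norm (W v - W u) * K"
          using B K \<open>u \<in> {a..b}\<close> \<open>v \<in> {a..b}\<close> by (intro add_mono mult_mono) auto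
        finally show "norm (h (U (Sup k)) (W (Sup k)) - h (U (Inf k)) (W (Inf k)))
          \<le> K * B2 * norm (U (Sup k) - U (Inf k)) + K * B1 * norm (W (Sup k) - W (Inf k))"
          using uv \<open>u \<le> v\<close> by (simp add: mult_ac)
      qed
      also have "\<dots> = K * B2 * (\<Sum>k\<in>D. norm (U (Sup k) - U (Inf k)))
          + K * B1 * (\<Sum>k\<in>D. norm (W (Sup k) - W (Inf k)))"
        by (simp add: sum.distrib sum_distrib_left)
      also have "\<dots> < K * B2 * (e / (2 * K * B2)) + K * B1 * (e / (2 * K * B1))"
        using d1(2)[OF D(1,2)] d2(2)[OF D(1,2)] D(3) K B
        by (intro add_strict_mono mult_strict_left_mono) auto
      also have "\<dots> = e" using K B by (simp add: field_simps)
      finally show ?thesis .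
    qed
    then show "\<exists>d>0. \<forall>D A. D division_of A \<and> A \<subseteq> {a..b} \<and> (\<Sum>k\<in>D. Sup k - Inf k) < d \<longrightarrow>
      (\<Sum>k\<in>D. norm (h (U (Sup k)) (W (Sup k)) - h (U (Inf k)) (W (Inf k)))) < e"
      using d1(1) d2(1) by (intro exI[of _ "min d1 d2"]) auto
  qed
qed

text \<open>Links measure to absolute continuity: intervals lying in a set of small measure have
  small total length, which is the quantity bounded in \<open>abs_cont_on\<close>.\<close>

lemma sum_length_division_le:
  fixes D :: "real set set"
  assumes D: "D division_of A" and A: "A \<subseteq> W" and W: "W \<in> lmeasurable"
  shows "(\<Sum>k\<in>D. Sup k - Inf k) \<le> measure lebesgue W"
proof -
  have "(\<Sum>k\<in>D. Sup k - Inf k) = (\<Sum>k\<in>D. measure lebesgue k)"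
  proof (rule sum.cong[OF refl])
    fix k assume k: "k \<in> D"
    obtain u v where "k = {u..v}" "k \<noteq> {}"
      using division_ofD[OF D] k by (metis box_real(2))
    then show "Sup k - Inf k = measure lebesgue k" by auto
  qed
  also have "\<dots> = measure lebesgue A" by (rule content_division[OF D])
  also have "\<dots> \<le> measure lebesgue W"
    using A W lmeasurable_division[OF D] by (intro measure_mono_fmeasurable) (auto simp: fmeasurableD)
  finally show ?thesis .
qed

text \<open>
  The gauge is the usual one off the exceptional null set \<open>N\<close>; on \<open>N\<close> it confines
  the division to an open set of small measure, where absolute continuity controls the increments.
\<close>
theorem abs_cont_on_has_integral:
  fixes U U' :: "real \<Rightarrow> 'a::banach"
  assumes ab: "a \<le> b" and U: "abs_cont_on {a..b} U" and N: "negligible N"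
    and der: "\<And>t. t \<in> {a..b} - N \<Longrightarrow> (U has_vector_derivative U' t) (at t within {a..b})"
  shows "(U' has_integral (U b - U a)) {a..b}"
proof (rule has_integral_spike[OF N])
  show "U' t = (if t \<in> N then 0 else U' t)" if "t \<in> {a..b} - N" for t
    using that by auto
  let ?g = "\<lambda>t. if t \<in> N then 0 else U' t"
  show "(?g has_integral (U b - U a)) {a..b}"
    unfolding has_integral_real
  proof (intro allI impI)
    fix e :: real assume e: "e > 0"
    obtain \<delta> where \<delta>: "\<delta> > 0" "\<And>D A. D division_of A \<Longrightarrow> A \<subseteq> {a..b} \<Longrightarrow> (\<Sum>k\<in>D. Sup k - Inf k) < \<delta> \<Longrightarrow>
      (\<Sum>k\<in>D. norm (U (Sup k) - U (Inf k))) < e / 2"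
      using U e unfolding abs_cont_on_def by (meson half_gt_zero)
    have "N \<in> sets lebesgue" using N by (simp add: negligible_iff_measure fmeasurableD)
    \<comment> \<open>\<open>W\<close> exceeds the null set \<open>N\<close> by measure less than
      \<open>\<delta>\<close>, hence has measure less than \<open>\<delta>\<close> itself; intervals
      tagged in \<open>N\<close> will be forced into \<open>W\<close>.\<close>
    then obtain W where W: "open W" "N \<subseteq> W" "W - N \<in> lmeasurable" "emeasure lebesgue (W - N) < ennreal \<delta>"
      using sets_lebesgue_outer_open \<delta>(1) by metis
    have Wm: "W \<in> lmeasurable"
      using W N negligible_iff_measure fmeasurable.Un[of "W - N" lebesgue N]
      by (metis Diff_partition Un_commute)
    have "measure lebesgue W = measure lebesgue (W - N)"
      using measure_negligible_symdiff[of W "W - N"] Wm N W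
      by (metis Diff_Diff_Int Diff_subset Un_Diff_cancel2 double_diff fmeasurableD measure_Diff_null_set negligible_iff_null_sets)
    then have mW: "measure lebesgue W < \<delta>"
      using W(3,4) by (metis \<delta>(1) emeasure_eq_measure2 ennreal_less_iff measure_nonneg)
    \<comment> \<open>The summand 1 keeps the denominator positive when a = b; the errors off
      \<open>N\<close> then add up to at most e/2.\<close>
    define c where "c = e / (2 * (b - a + 1))"
    have c: "c > 0" using e ab by (auto simp: c_def)
    have "\<exists>d>0. (t \<in> {a..b} - N \<longrightarrow> (\<forall>y\<in>{a..b}. norm (y-t) < d \<longrightarrow>
        norm (U y - U t - (y-t) *\<^sub>R U' t) \<le> c * norm (y-t))) \<and> (t \<in> N \<longrightarrow> ball t d \<subseteq> W)" for t
    proof (cases "t \<in> N")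
      case True
      then show ?thesis using W by (metis Diff_iff openE subsetD)
    next
      case False
      then show ?thesis
      proof (cases "t \<in> {a..b}")
        case True
        with False der[of t] c show ?thesis
          unfolding has_vector_derivative_def has_derivative_within_alt by blast
      qed (use False in \<open>auto intro: exI[of _ 1]\<close>)
    qed
    then obtain d where d: "\<And>t. d t > 0"
      "\<And>t y. t \<in> {a..b} - N \<Longrightarrow> y \<in> {a..b} \<Longrightarrow> norm (y-t) < d t \<Longrightarrow>
        norm (U y - U t - (y-t) *\<^sub>R U' t) \<le> c * norm (y-t)"
      "\<And>t. t \<in> N \<Longrightarrow> ball t (d t) \<subseteq> W" by metis
    have "norm ((\<Sum>(x,K)\<in>p. measure lborel K *\<^sub>R ?g x) - (U b - U a)) < e"
      if p: "p tagged_division_of {a..b}" and fine: "(\<lambda>x. ball x (d x)) fine p" for p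
    proof -
      have ptag: "p tagged_division_of cbox a b" using p by (simp add: box_real)
      have fin: "finite p" using p by blast
      have ba: "b - a = (\<Sum>(x,K)\<in>p. Sup K - Inf K)" and Uba: "U b - U a = (\<Sum>(x,K)\<in>p. U(Sup K) - U(Inf K))"
        using additive_tagged_division_1[where f= "\<lambda>x. x"] additive_tagged_division_1[where f= U] ab p by auto
      have K: "\<exists>u v. K = {u..v} \<and> u \<le> v \<and> x \<in> K \<and> K \<subseteq> {a..b} \<and> K \<subseteq> ball x (d x)" if "(x,K) \<in> p" for x K
        using tagged_division_ofD(2-4)[OF p that] fine that unfolding fine_def
        by (metis (no_types, lifting) atLeastatMost_empty_iff2 box_real(2) case_prodD empty_iff)
      define q where "q = {(x,K) \<in> p. x \<in> N}"
      have q: "q \<subseteq> p" "finite q" using fin by (auto simp: q_def intro: finite_subset)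
      have qtag: "q tagged_division_of (\<Union>(snd ` q))"
        using tagged_partial_division_of_Union_self tagged_partial_division_subset[OF _ q(1)]
          p[unfolded tagged_division_of_def] by blast
      have "norm ((\<Sum>(x,K)\<in>p. measure lborel K *\<^sub>R ?g x) - (U b - U a))
         = norm (\<Sum>z\<in>p. case z of (x,K) \<Rightarrow> measure lborel K *\<^sub>R ?g x - (U(Sup K) - U(Inf K)))"
        unfolding Uba sum_subtractf[symmetric] by (simp add: split_def)
      also have "\<dots> \<le> (\<Sum>z\<in>p. case z of (x,K) \<Rightarrow> (if x \<in> N then norm (U(Sup K) - U(Inf K)) else 0) + c * (Sup K - Inf K))"
      proof (rule sum_norm_le, safe)
        fix x K assume xK: "(x,K) \<in> p"
        obtain u v where uv: "K = {u..v}" "u \<le> v" "x \<in> K" "K \<subseteq> {a..b}" "K \<subseteq> ball x (d x)"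
          using K[OF xK] by blast
        show "norm (measure lborel K *\<^sub>R ?g x - (U(Sup K) - U(Inf K)))
           \<le> (if x \<in> N then norm (U(Sup K) - U(Inf K)) else 0) + c * (Sup K - Inf K)"
        proof (cases "x \<in> N")
          case True
          then show ?thesis using uv c by (simp add: norm_minus_commute)
        next
          case False
          \<comment> \<open>Straddle estimate: both endpoints are compared with the tag, and since u
            \<le> x \<le> v the two distances add up to v - u.\<close>
          have "norm ((v - u) *\<^sub>R U' x - (U v - U u))
            = norm (U u - U x - (u - x) *\<^sub>R U' x - (U v - U x - (v - x) *\<^sub>R U' x))"
            by (auto simp: algebra_simps)
          also have "\<dots> \<le> norm (U u - U x - (u - x) *\<^sub>R U' x) + norm (U v - U x - (v - x) *\<^sub>R U' x)"
            by (rule norm_triangle_ineq4)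
          also have "\<dots> \<le> c * norm (u - x) + c * norm (v - x)"
          proof (rule add_mono)
            have "u \<in> ball x (d x)" "v \<in> ball x (d x)" using uv(2,5) unfolding uv(1) subset_iff by simp_all
            then have "norm (u - x) < d x" "norm (v - x) < d x"
              by (auto simp: dist_real_def)
            then show "norm (U u - U x - (u - x) *\<^sub>R U' x) \<le> c * norm (u - x)"
               "norm (U v - U x - (v - x) *\<^sub>R U' x) \<le> c * norm (v - x)"
              using uv False by (intro d(2); auto)+
          qed
          also have "\<dots> = c * (v - u)" using uv by (simp add: algebra_simps)
          finally show ?thesis using uv False by simp
        qed
      qed
      also have "\<dots> = (\<Sum>(x,K)\<in>p. if x \<in> N then norm (U(Sup K) - U(Inf K)) else 0) + c * (b - a)"
        unfolding ba by (simp add: split_def sum.distrib sum_distrib_left)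
      also have "(\<Sum>(x,K)\<in>p. if x \<in> N then norm (U(Sup K) - U(Inf K)) else 0)
          = (\<Sum>(x,K)\<in>q. norm (U(Sup K) - U(Inf K)))"
        unfolding q_def by (rule sum.mono_neutral_cong_right[OF fin]) (auto split: if_splits)
      \<comment> \<open>Passing from tagged pairs to intervals requires a summand that vanishes on
        every \<open>cbox u v\<close> with empty interior. For v < u this is the empty set, whose
        \<open>Sup\<close> and \<open>Inf\<close> are unspecified, hence the guard.\<close>
      also have "\<dots> = (\<Sum>(x,K)\<in>q. if K = {} then 0 else norm (U(Sup K) - U(Inf K)))"
        using K q(1) by (intro sum.cong) fastforce+
      also have "\<dots> = (\<Sum>K\<in>snd ` q. if K = {} then 0 else norm (U(Sup K) - U(Inf K)))"
      proof (rule sum.over_tagged_division_lemma[OF qtag])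
        fix u v :: real assume "box u v = {}"
        then have "v \<le> u" by simp
        then show "(if cbox u v = {} then 0 else norm (U (Sup (cbox u v)) - U (Inf (cbox u v)))) = 0"
          by (cases "u = v") auto
      qed
      also have "\<dots> = (\<Sum>K\<in>snd ` q. norm (U(Sup K) - U(Inf K)))"
        using K q(1) by (intro sum.cong) fastforce+
      also have "\<dots> < e / 2"
      proof (rule \<delta>(2)[OF division_of_tagged_division[OF qtag]])
        show sub: "\<Union> (snd ` q) \<subseteq> {a..b}" using K q(1) by fastforce
        have "\<Union> (snd ` q) \<subseteq> W" using K d(3) unfolding q_def by fastforce
        then show "(\<Sum>k\<in>snd ` q. Sup k - Inf k) < \<delta>"
          using sum_length_division_le[OF division_of_tagged_division[OF qtag] _ Wm] mW by fastforce
      qed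
      also have "e / 2 + c * (b - a) \<le> e / 2 + c * (b - a + 1)"
        using c by simp
      also have "\<dots> = e" using ab by (simp add: c_def field_simps)
      finally show ?thesis by auto
    qed
    moreover have "gauge (\<lambda>x. ball x (d x))" using d(1) gauge_ball_dependent by blast
    ultimately show "\<exists>\<gamma>. gauge \<gamma> \<and> (\<forall>p. p tagged_division_of {a..b} \<and> \<gamma> fine p \<longrightarrow>
        norm ((\<Sum>(x,K)\<in>p. measure lborel K *\<^sub>R ?g x) - (U b - U a)) < e)"
      by blast
  qed
qed

text \<open>Truncation: the part of the norm of f above a level n has integral below e/2 for large
  n, whatever the division, and the part below n contributes at most n times the total length. The
  length bound e / (2(n+1)) uses n + 1 so that n = 0 causes no division by zero.\<close>

lemma abs_cont_on_integral:
  fixes f :: "real \<Rightarrow> 'a::euclidean_space"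
  assumes f: "f absolutely_integrable_on {a..b}"
  shows "abs_cont_on {a..b} (\<lambda>t. integral {a..t} f)"
  unfolding abs_cont_on_def
proof (intro allI impI)
  fix e :: real assume e: "e > 0"
  let ?g = "\<lambda>t. norm (f t)"
  have fi: "f integrable_on {a..b}" and ga: "?g absolutely_integrable_on {a..b}"
    using f by (auto simp: absolutely_integrable_on_def)
  then have gi: "?g integrable_on {a..b}" by (auto simp: absolutely_integrable_on_def)
  have mi: "(\<lambda>t. min (?g t) (real n)) integrable_on {a..b}" for n
    using absolutely_integrable_min_1[OF ga, of "\<lambda>_. real n"]
    by (auto simp: absolutely_integrable_on_def)
  have "(\<lambda>n. integral {a..b} (\<lambda>t. min (?g t) (real n))) \<longlonglongrightarrow> integral {a..b} ?g"
  proof (rule dominated_convergence(2)[OF mi gi])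
    show "(\<lambda>n. min (?g t) (real n)) \<longlonglongrightarrow> ?g t" for t
    proof (rule tendsto_eventually)
      obtain n0 where "?g t \<le> real n0" using real_arch_simple by blast
      then show "\<forall>\<^sub>F n in sequentially. min (?g t) (real n) = ?g t"
        by (intro eventually_sequentiallyI[of n0]) (auto simp: min_def)
    qed
  qed auto
  then have "\<forall>\<^sub>F n in sequentially. dist (integral {a..b} (\<lambda>t. min (?g t) (real n))) (integral {a..b} ?g) < e / 2"
    using e by (intro tendstoD) auto
  then obtain n where n: "dist (integral {a..b} (\<lambda>t. min (?g t) (real n))) (integral {a..b} ?g) < e / 2"
    using eventually_happens' sequentially_bot by blast
  define r where "r = (\<lambda>t. ?g t - min (?g t) (real n))"
  have ri: "r integrable_on {a..b}" unfolding r_def using gi mi by (rule integrable_diff)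
  have r0: "r t \<ge> 0" for t by (simp add: r_def)
  have rs: "integral {a..b} r < e / 2"
    using n integral_diff[OF gi mi[of n]] unfolding r_def dist_real_def by linarith
  have "(\<Sum>k\<in>D. norm (integral {a..Sup k} f - integral {a..Inf k} f)) < e"
    if D: "D division_of A" "A \<subseteq> {a..b}" and len: "(\<Sum>k\<in>D. Sup k - Inf k) < e / (2 * (real n + 1))" for D A
  proof -
    have "(\<Sum>k\<in>D. norm (integral {a..Sup k} f - integral {a..Inf k} f))
       \<le> (\<Sum>k\<in>D. integral k r + real n * (Sup k - Inf k))"
    proof (rule sum_mono)
      fix k assume k: "k \<in> D"
      obtain u v where uv: "k = {u..v}" "k \<noteq> {}"
        using division_ofD[OF D(1)] k by (metis box_real(2))
      then have "u \<le> v" and k': "k \<subseteq> {a..b}" and uv': "a \<le> u" "v \<le> b"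
        using subset_trans[OF division_ofD(2)[OF D(1) k] D(2)] by auto
      have sub: "h integrable_on k" if "h integrable_on {a..b}" for h :: "real \<Rightarrow> real"
        using integrable_on_subinterval[OF that] k' uv by simp
      have fk: "f integrable_on k" using integrable_on_subinterval[OF fi] k' uv by simp
      have "integral {a..v} f - integral {a..u} f = integral k f"
        using Henstock_Kurzweil_Integration.integral_combine[of a u v f]
          integrable_on_subinterval[OF fi, of a v] \<open>u \<le> v\<close> uv uv' by (simp add: algebra_simps)
      then have "norm (integral {a..v} f - integral {a..u} f) \<le> integral k ?g"
        using integral_norm_bound_integral[OF fk sub[OF gi]] by simp
      also have "\<dots> \<le> integral k (\<lambda>t. r t + real n)"
        using uv by (intro integral_le sub gi ri integrable_add) (auto simp: r_def)
      also have "\<dots> = integral k r + real n * (v - u)"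
        using uv \<open>u \<le> v\<close> sub[OF ri] by (subst integral_add) auto
      finally show "norm (integral {a..Sup k} f - integral {a..Inf k} f)
         \<le> integral k r + real n * (Sup k - Inf k)" using uv \<open>u \<le> v\<close> by simp
    qed
    also have "\<dots> = (\<Sum>k\<in>D. integral k r) + real n * (\<Sum>k\<in>D. Sup k - Inf k)"
      by (simp add: sum.distrib sum_distrib_left)
    also have "(\<Sum>k\<in>D. integral k r) = integral A r"
      using integral_combine_division_topdown[OF integrable_on_subdivision[OF D(1) ri D(2)] D(1)] by simp
    also have "\<dots> \<le> integral {a..b} r"
      using D r0 ri integrable_on_subdivision[OF D(1) ri D(2)] by (intro integral_subset_le) auto
    also have "integral {a..b} r + real n * (\<Sum>k\<in>D. Sup k - Inf k) < e / 2 + real n * (e / (2 * (real n + 1)))"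
      using rs len by (intro add_less_le_mono mult_left_mono) auto
    also have "\<dots> \<le> e" using e by (simp add: field_simps)
    finally show ?thesis by simp
  qed
  then show "\<exists>\<delta>>0. \<forall>D A. D division_of A \<and> A \<subseteq> {a..b} \<and> (\<Sum>k\<in>D. Sup k - Inf k) < \<delta> \<longrightarrow>
      (\<Sum>k\<in>D. norm (integral {a..Sup k} f - integral {a..Inf k} f)) < e"
    using e by (intro exI[of _ "e / (2 * (real n + 1))"]) auto
qed

text \<open>Lebesgue differentiation. \<open>integrable_ccontinuous_explicit\<close> controls
  averages over [x, x+h]; applying it also to the reflected function t \<mapsto> g(-t) controls the
  averages to the left of x, so the exceptional set is \<open>N1\<close> together with the mirror
  image of \<open>N2\<close>.\<close>

lemma integral_has_vector_derivative_AE: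
  fixes f :: "real \<Rightarrow> 'a::euclidean_space"
  assumes f: "f integrable_on {a..b}"
  obtains N where "negligible N"
    "\<And>t. t \<in> {a..b} - N \<Longrightarrow> ((\<lambda>t. integral {a..t} f) has_vector_derivative f t) (at t within {a..b})"
proof -
  \<comment> \<open>Extension by zero makes averages meaningful for intervals that leave
    \<open>{a..b}\<close>.\<close>
  define g where "g = (\<lambda>t. if t \<in> {a..b} then f t else 0)"
  have "g integrable_on UNIV" unfolding g_def using f integrable_restrict_UNIV by blast
  then have gi: "g integrable_on cbox u v" for u v using integrable_on_subcbox by blast
  have gm: "(\<lambda>t. g (- t)) integrable_on cbox u v" for u v
    using Henstock_Kurzweil_Integration.integrable_reflect_real[of g "-u" "-v"] gi by simp
  obtain N1 where N1: "negligible N1" "\<And>x e. x \<notin> N1 \<Longrightarrow> e > 0 \<Longrightarrow>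
     \<exists>d>0. \<forall>h. 0 < h \<and> h < d \<longrightarrow> norm (integral {x..x+h} g /\<^sub>R h - g x) < e"
    using integrable_ccontinuous_explicit[OF gi] by auto
  obtain N2 where N2: "negligible N2" "\<And>x e. x \<notin> N2 \<Longrightarrow> e > 0 \<Longrightarrow>
     \<exists>d>0. \<forall>h. 0 < h \<and> h < d \<longrightarrow> norm (integral {x..x+h} (\<lambda>t. g (-t)) /\<^sub>R h - g (-x)) < e"
    using integrable_ccontinuous_explicit[OF gm] by auto
  have "negligible (uminus ` N2)"
    by (rule negligible_locally_Lipschitz_image[OF _ N2(1)])
      (simp, rule exI[of _ UNIV], rule exI[of _ 1], auto)
  then have "negligible (N1 \<union> uminus ` N2)" using N1(1) by simp
  moreover have "((\<lambda>t. integral {a..t} f) has_vector_derivative f t) (at t within {a..b})"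
    if t: "t \<in> {a..b} - (N1 \<union> uminus ` N2)" for t
    unfolding has_vector_derivative_def has_derivative_within_alt
  proof (intro conjI allI impI)
    show "bounded_linear (\<lambda>h. h *\<^sub>R f t)" by (rule bounded_linear_scaleR_left)
    fix e :: real assume e: "e > 0"
    have t1: "t \<notin> N1" and t2: "- t \<notin> N2" using t by (auto simp: image_iff)
    obtain d1 where d1: "d1 > 0" "\<And>h. 0 < h \<Longrightarrow> h < d1 \<Longrightarrow> norm (integral {t..t+h} g /\<^sub>R h - g t) < e"
      using N1(2)[OF t1 e] by blast
    obtain d2 where d2: "d2 > 0" "\<And>h. 0 < h \<Longrightarrow> h < d2 \<Longrightarrow>
        norm (integral {-t..-t+h} (\<lambda>t. g (-t)) /\<^sub>R h - g t) < e"
      using N2(2)[OF t2 e] by auto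
    have diff: "integral {a..v} f - integral {a..u} f = integral {u..v} g"
      if "u \<in> {a..b}" "v \<in> {a..b}" "u \<le> v" for u v
    proof -
      have "integral {a..v} f - integral {a..u} f = integral {u..v} f"
        using Henstock_Kurzweil_Integration.integral_combine[of a u v f]
          integrable_on_subinterval[OF f, of a v] that by (simp add: algebra_simps)
      also have "\<dots> = integral {u..v} g"
        using that by (intro integral_cong) (auto simp: g_def)
      finally show ?thesis .
    qed
    have gt: "g t = f t" using t by (simp add: g_def)
    have key: "norm (I - h *\<^sub>R f t) \<le> e * h" if "norm (I /\<^sub>R h - g t) < e" "h > 0" for I h
    proof -
      have "I - h *\<^sub>R f t = h *\<^sub>R (I /\<^sub>R h - g t)" using that gt by (simp add: algebra_simps)
      then have "norm (I - h *\<^sub>R f t) = h * norm (I /\<^sub>R h - g t)" using that by simp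
      also have "\<dots> \<le> h * e" using that by (intro mult_left_mono) auto
      finally show ?thesis by (simp add: mult.commute)
    qed
    have "norm (integral {a..y} f - integral {a..t} f - (y - t) *\<^sub>R f t) \<le> e * norm (y - t)"
      if y: "y \<in> {a..b}" "norm (y - t) < min d1 d2" for y
    proof (cases y t rule: linorder_cases)
      case greater
      then have "norm (integral {t..y} g - (y - t) *\<^sub>R f t) \<le> e * (y - t)"
        using d1(2)[of "y - t"] y by (intro key) auto
      then show ?thesis using diff[of t y] t y greater by auto
    next
      case less
      have "integral {y..t} g = integral {-t..-y} (\<lambda>t. g (-t))" by simp
      moreover have "norm (integral {-t..-y} (\<lambda>t. g (-t)) - (t - y) *\<^sub>R f t) \<le> e * (t - y)"
        using d2(2)[of "t - y"] y less by (intro key) auto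
      ultimately have "norm (integral {y..t} g - (t - y) *\<^sub>R f t) \<le> e * (t - y)" by simp
      moreover have "integral {a..y} f - integral {a..t} f - (y - t) *\<^sub>R f t = - (integral {y..t} g - (t - y) *\<^sub>R f t)"
        using diff[of y t] t y less by (simp add: algebra_simps)
      ultimately show ?thesis using less by (simp only: norm_minus_cancel) simp
    qed simp
    then show "\<exists>d>0. \<forall>y\<in>{a..b}. norm (y - t) < d \<longrightarrow>
       norm (integral {a..y} f - integral {a..t} f - (y - t) *\<^sub>R f t) \<le> e * norm (y - t)"
      using d1(1) d2(1) by (intro exI[of _ "min d1 d2"]) auto
  qed
  ultimately show ?thesis using that by blast
qed

lemma abs_cont_on_bilinear_has_integral:
  fixes h :: "'a::real_normed_vector \<Rightarrow> 'b::real_normed_vector \<Rightarrow> 'c::banach"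
  assumes h: "bounded_bilinear h" and ab: "a \<le> b"
    and U: "abs_cont_on {a..b} U" and W: "abs_cont_on {a..b} W" and N: "negligible N"
    and dU: "\<And>t. t \<in> {a..b} - N \<Longrightarrow> (U has_vector_derivative U' t) (at t within {a..b})"
    and dW: "\<And>t. t \<in> {a..b} - N \<Longrightarrow> (W has_vector_derivative W' t) (at t within {a..b})"
  shows "((\<lambda>t. h (U t) (W' t) + h (U' t) (W t)) has_integral (h (U b) (W b) - h (U a) (W a))) {a..b}"
  by (rule abs_cont_on_has_integral[OF ab abs_cont_on_bilinear[OF h U W] N])
    (rule bounded_bilinear.has_vector_derivative[OF h dU dW])

lemma abs_cont_on_const_add: "abs_cont_on S F \<Longrightarrow> abs_cont_on S (\<lambda>t. c + F t)"
  by (simp add: abs_cont_on_def)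

lemma abs_cont_on_const: "abs_cont_on S (\<lambda>t. c)"
  unfolding abs_cont_on_def by (auto intro: exI[of _ 1])

lemma abs_cont_on_power:
  fixes F :: "real \<Rightarrow> real"
  assumes "abs_cont_on {a..b} F"
  shows "abs_cont_on {a..b} (\<lambda>t. F t ^ n)"
proof (induction n)
  case (Suc n)
  show ?case using abs_cont_on_bilinear[OF bounded_bilinear_mult assms Suc] by simp
qed (simp add: abs_cont_on_const)

subsection \<open>Linear differential equations with integrable coefficients\<close>

lemma absolutely_integrable_on_bilinear_continuous:
  fixes h :: "'a::euclidean_space \<Rightarrow> 'b::euclidean_space \<Rightarrow> 'c::euclidean_space" and a b :: real
  assumes h: "bounded_bilinear h" and A: "A absolutely_integrable_on {a..b}" and X: "continuous_on {a..b} X"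
  shows "(\<lambda>s. h (A s) (X s)) absolutely_integrable_on {a..b}"
proof (rule absolutely_integrable_bounded_measurable_product[where h="\<lambda>x y. h y x" and f=X and g=A])
  show "bilinear (\<lambda>x y. h y x)"
    using h bilinear_conv_bounded_bilinear bounded_bilinear.flip by blast
  show "X \<in> borel_measurable (lebesgue_on {a..b})"
    using X by (rule continuous_imp_measurable_on_sets_lebesgue) auto
  show "bounded (X ` {a..b})" using X by (simp add: compact_continuous_image compact_imp_bounded)
qed (use A in auto)

text \<open>F^(n+1) is absolutely continuous with almost everywhere derivative (n+1) |A| F^n. This
  is the recursion behind the factorial decay of the iterated integrals: for integrable coefficients
  F(t) takes the role that t has for bounded ones.\<close>

lemma integral_norm_times_power:
  fixes A :: "real \<Rightarrow> 'a::euclidean_space"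
  assumes A: "A absolutely_integrable_on {a..b}" and t: "t \<in> {a..b}"
  defines "F \<equiv> \<lambda>t. integral {a..t} (\<lambda>s. norm (A s))"
  shows "((\<lambda>s. norm (A s) * F s ^ n) has_integral F t ^ Suc n / real (Suc n)) {a..t}"
proof -
  have nA: "(\<lambda>s. norm (A s)) absolutely_integrable_on {a..b}"
    using A by (auto simp: absolutely_integrable_on_def)
  then have ni: "(\<lambda>s. norm (A s)) integrable_on {a..b}" by (auto simp: absolutely_integrable_on_def)
  obtain N where N: "negligible N"
    "\<And>s. s \<in> {a..b} - N \<Longrightarrow> (F has_vector_derivative norm (A s)) (at s within {a..b})"
    using integral_has_vector_derivative_AE[OF ni] unfolding F_def by blast
  have ac: "abs_cont_on {a..t} (\<lambda>t. F t ^ Suc n)"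
    using abs_cont_on_subset[OF abs_cont_on_power[OF abs_cont_on_integral[OF nA]], of "{a..t}"] t
    unfolding F_def by (auto simp del: power_Suc)
  have "((\<lambda>s. real (Suc n) * (norm (A s) * F s ^ n)) has_integral F t ^ Suc n - F a ^ Suc n) {a..t}"
  proof (rule abs_cont_on_has_integral[OF _ ac N(1)])
    fix s assume s: "s \<in> {a..t} - N"
    then have "(F has_real_derivative norm (A s)) (at s within {a..t})"
      using has_vector_derivative_within_subset[OF N(2), of s "{a..t}"] t
      by (auto simp: has_real_derivative_iff_has_vector_derivative)
    from DERIV_power[OF this, of "Suc n"]
    show "((\<lambda>t. F t ^ Suc n) has_vector_derivative real (Suc n) * (norm (A s) * F s ^ n)) (at s within {a..t})"
      by (simp add: has_real_derivative_iff_has_vector_derivative[symmetric] mult_ac)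
  qed (use t in auto)
  then have "((\<lambda>s. real (Suc n) * (norm (A s) * F s ^ n)) has_integral F t ^ Suc n) {a..t}"
    by (simp add: F_def)
  from has_integral_mult_right[OF this, of "1 / real (Suc n)"] show ?thesis by simp
qed

text \<open>Peano-Baker series: \<open>X n\<close> is the n-fold iterated integral, bounded by |x0|
  (K F)^n / n!. The sum converges uniformly on the whole interval at once, so no gluing of short
  intervals is required, and dominated convergence carries the integral equation over to the
  limit.\<close>

theorem linear_ode_exists:
  fixes h :: "'b::euclidean_space \<Rightarrow> 'a::euclidean_space \<Rightarrow> 'a"
  assumes h: "bounded_bilinear h" and ab: "a \<le> b" and A: "A absolutely_integrable_on {a..b}"
  shows "\<exists>U. abs_cont_on {a..b} U \<and> U a = x0 \<and> (\<exists>N. negligible N \<and>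
    (\<forall>t \<in> {a..b} - N. (U has_vector_derivative h (A t) (U t)) (at t within {a..b})))"
proof -
  interpret h: bounded_bilinear h by fact
  obtain K where K: "K > 0" "\<And>x y. norm (h x y) \<le> norm x * norm y * K"
    using h.pos_bounded by blast
  define X where "X = rec_nat (\<lambda>_. x0) (\<lambda>_ Y t. integral {a..t} (\<lambda>s. h (A s) (Y s)))"
  have X0: "X 0 = (\<lambda>_. x0)" and XS: "X (Suc n) = (\<lambda>t. integral {a..t} (\<lambda>s. h (A s) (X n s)))" for n
    by (simp_all add: X_def)
  have hY: "(\<lambda>s. h (A s) (Y s)) absolutely_integrable_on {a..b}" if "continuous_on {a..b} Y" for Y
    using absolutely_integrable_on_bilinear_continuous[OF h A that] .
  have hYi: "(\<lambda>s. h (A s) (Y s)) integrable_on {a..t}" if "continuous_on {a..b} Y" "t \<in> {a..b}" for Y t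
    using hY[OF that(1)] that(2) integrable_on_subinterval[of _ "{a..b}" a t]
    by (auto simp: absolutely_integrable_on_def)
  have Xc: "continuous_on {a..b} (X n)" for n
  proof (induction n)
    case (Suc n)
    show ?case unfolding XS
      by (rule abs_cont_on_imp_continuous_on[OF abs_cont_on_integral[OF hY[OF Suc]]])
  qed (simp add: X0)
  define F where "F = (\<lambda>t. integral {a..t} (\<lambda>s. norm (A s)))"
  have ni: "(\<lambda>s. norm (A s)) integrable_on {a..t}" if "t \<in> {a..b}" for t
    using A integrable_on_subinterval[of "\<lambda>s. norm (A s)" "{a..b}" a t] that by (auto simp: absolutely_integrable_on_def)
  have F: "0 \<le> F t" "F t \<le> F b" if "t \<in> {a..b}" for t
    using that ab unfolding F_def by (auto intro!: integral_nonneg integral_subset_le ni)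
  have bd: "norm (X n t) \<le> norm x0 * (K * F t) ^ n / fact n" if "t \<in> {a..b}" for n t
    using that
  proof (induction n arbitrary: t)
    case (Suc n)
    let ?c = "K * norm x0 * K ^ n / fact n"
    have I: "((\<lambda>s. ?c * (norm (A s) * F s ^ n)) has_integral ?c * (F t ^ Suc n / real (Suc n))) {a..t}"
      unfolding F_def by (intro has_integral_mult_right integral_norm_times_power[OF A Suc.prems])
    have "norm (X (Suc n) t) \<le> integral {a..t} (\<lambda>s. ?c * (norm (A s) * F s ^ n))"
      unfolding XS
    proof (rule integral_norm_bound_integral)
      show "(\<lambda>s. h (A s) (X n s)) integrable_on {a..t}" by (rule hYi[OF Xc Suc.prems])
      show "(\<lambda>s. ?c * (norm (A s) * F s ^ n)) integrable_on {a..t}" using I by blast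
      fix s assume "s \<in> {a..t}"
      then have "norm (X n s) \<le> norm x0 * (K * F s) ^ n / fact n"
        using Suc.IH[of s] Suc.prems by auto
      then have "norm (A s) * norm (X n s) * K \<le> norm (A s) * (norm x0 * (K * F s) ^ n / fact n) * K"
        using K by (intro mult_left_mono mult_right_mono) auto
      also have "\<dots> = ?c * (norm (A s) * F s ^ n)" by (simp add: power_mult_distrib)
      finally show "norm (h (A s) (X n s)) \<le> ?c * (norm (A s) * F s ^ n)"
        using K(2)[of "A s" "X n s"] by linarith
    qed
    also have "\<dots> = ?c * (F t ^ Suc n / real (Suc n))" by (rule integral_unique[OF I])
    also have "\<dots> = norm x0 * (K * F t) ^ Suc n / fact (Suc n)"
      by (simp add: power_mult_distrib mult_ac)
    finally show ?case .
  qed (simp add: X0)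
  define M where "M = (\<lambda>n. norm x0 * (K * F b) ^ n / fact n)"
  have XM: "norm (X n t) \<le> M n" if "t \<in> {a..b}" for n t
  proof -
    have "(K * F t) ^ n \<le> (K * F b) ^ n"
      using K F[OF that] by (intro power_mono mult_left_mono) auto
    then show ?thesis unfolding M_def
      by (intro order_trans[OF bd[OF that]] divide_right_mono mult_left_mono) auto
  qed
  have Ms: "summable M"
    unfolding M_def using summable_mult[OF summable_exp[of "K * F b"], of "norm x0"]
    by (simp add: field_simps)
  have M0: "M n \<ge> 0" for n using K F[of b] ab by (auto simp: M_def)
  define U where "U = (\<lambda>t. \<Sum>n. X n t)"
  define S where "S = (\<lambda>N t. \<Sum>n<N. X n t)"
  have lim: "uniform_limit {a..b} S U sequentially"
    unfolding S_def U_def by (rule Weierstrass_m_test[OF XM Ms])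
  have Sc: "continuous_on {a..b} (S N)" for N
    unfolding S_def by (intro continuous_intros Xc)
  have Uc: "continuous_on {a..b} U"
    by (rule uniform_limit_theorem[OF _ lim]) (auto simp: Sc)
  have Sb: "norm (S N t) \<le> suminf M" if "t \<in> {a..b}" for N t
  proof -
    have "norm (S N t) \<le> (\<Sum>n<N. M n)" unfolding S_def by (intro sum_norm_le XM that)
    also have "\<dots> \<le> suminf M" by (intro sum_le_suminf Ms) (auto simp: M0)
    finally show ?thesis .
  qed
  have SS: "S (Suc N) t = x0 + integral {a..t} (\<lambda>s. h (A s) (S N s))" if "t \<in> {a..b}" for N t
  proof -
    have "S (Suc N) t = x0 + (\<Sum>n<N. X (Suc n) t)"
      unfolding S_def by (simp add: sum.lessThan_Suc_shift X0 del: sum.lessThan_Suc)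
    also have "(\<Sum>n<N. X (Suc n) t) = integral {a..t} (\<lambda>s. \<Sum>n<N. h (A s) (X n s))"
      unfolding XS by (rule integral_sum[symmetric]) (auto intro: hYi[OF Xc that])
    finally show ?thesis by (simp add: S_def h.sum_right)
  qed
  have Ueq: "U t = x0 + integral {a..t} (\<lambda>s. h (A s) (U s))" if t: "t \<in> {a..b}" for t
  proof (rule LIMSEQ_unique)
    show "(\<lambda>N. S (Suc N) t) \<longlonglongrightarrow> U t"
      using tendsto_uniform_limitI[OF lim t] by (rule LIMSEQ_Suc)
    have "(\<lambda>N. integral {a..t} (\<lambda>s. h (A s) (S N s))) \<longlonglongrightarrow> integral {a..t} (\<lambda>s. h (A s) (U s))"
    proof (rule dominated_convergence(2))
      show "(\<lambda>s. h (A s) (S N s)) integrable_on {a..t}" for N by (rule hYi[OF Sc t])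
      show "(\<lambda>s. norm (A s) * (suminf M * K)) integrable_on {a..t}"
        by (rule integrable_on_mult_left[OF ni[OF t]])
      fix s assume "s \<in> {a..t}"
      then have s: "s \<in> {a..b}" using t by auto
      have "norm (A s) * norm (S N s) * K \<le> norm (A s) * suminf M * K" for N
        using K by (intro mult_left_mono mult_right_mono Sb[OF s]) auto
      then show "norm (h (A s) (S N s)) \<le> norm (A s) * (suminf M * K)" for N
        using K(2)[of "A s" "S N s"] by (simp add: mult.assoc) (meson order_trans)
      show "(\<lambda>N. h (A s) (S N s)) \<longlonglongrightarrow> h (A s) (U s)"
        by (intro h.tendsto tendsto_const tendsto_uniform_limitI[OF lim s])
    qed
    then show "(\<lambda>N. S (Suc N) t) \<longlonglongrightarrow> x0 + integral {a..t} (\<lambda>s. h (A s) (U s))"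
      unfolding SS[OF t] by (intro tendsto_add tendsto_const)
  qed
  \<comment> \<open>\<open>W\<close> agrees with the series on \<open>{a..b}\<close> but is
    literally an indefinite integral, so absolute continuity, initial value and derivative can be
    read off directly.\<close>
  define W where "W = (\<lambda>t. x0 + integral {a..t} (\<lambda>s. h (A s) (U s)))"
  obtain N where N: "negligible N"
    "\<And>t. t \<in> {a..b} - N \<Longrightarrow> ((\<lambda>t. integral {a..t} (\<lambda>s. h (A s) (U s))) has_vector_derivative h (A t) (U t)) (at t within {a..b})"
    using integral_has_vector_derivative_AE[OF hYi[OF Uc]] ab by auto
  show ?thesis
  proof (intro exI conjI ballI)
    show "abs_cont_on {a..b} W"
      unfolding W_def by (intro abs_cont_on_const_add abs_cont_on_integral hY Uc)
    show "W a = x0" by (simp add: W_def)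
    show "negligible N" by (rule N(1))
    fix t assume t: "t \<in> {a..b} - N"
    then have "W t = U t" using Ueq by (simp add: W_def)
    then show "(W has_vector_derivative h (A t) (W t)) (at t within {a..b})"
      using has_vector_derivative_add[OF has_vector_derivative_const N(2)[OF t], of x0] by (simp add: W_def)
  qed
qed

subsection \<open>Schroedinger evolution\<close>

lemma bounded_bilinear_matrix_matrix_mult:
  "bounded_bilinear ((**) :: complex^'n^'m \<Rightarrow> complex^'p^'n \<Rightarrow> complex^'p^'m)"
  unfolding bilinear_conv_bounded_bilinear[symmetric] bilinear_def
  by (auto intro!: linearI simp: matrix_add_ldistrib matrix_matrix_mult_def vec_eq_iff
      sum.distrib scaleR_sum_right algebra_simps)

lemma ctranspose_nth: "ctranspose A $ i $ j = cnj (A $ j $ i)"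
  by (simp add: ctranspose_def map_matrix_def transpose_def)

lemma ctranspose_mult: "ctranspose (A ** B) = ctranspose B ** ctranspose A"
  by (simp add: vec_eq_iff ctranspose_nth matrix_matrix_mult_def mult.commute)

lemma ctranspose_add: "ctranspose (A + B) = ctranspose A + ctranspose B"
  by (simp add: vec_eq_iff ctranspose_nth)

lemma ctranspose_scaleR: "ctranspose (r *\<^sub>R A) = r *\<^sub>R ctranspose A"
  by (simp add: vec_eq_iff ctranspose_nth)

lemma ctranspose_mat: "ctranspose (mat c) = mat (cnj c)"
  by (simp add: vec_eq_iff ctranspose_nth mat_def)

lemma bounded_linear_ctranspose: "bounded_linear (ctranspose :: complex^'n^'m \<Rightarrow> _)"
  by (simp add: linear_conv_bounded_linear[symmetric] linearI ctranspose_add ctranspose_scaleR)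

lemma mat_mult_nth: "(mat c ** A) $ i $ j = c * A $ i $ j"
  by (simp add: matrix_matrix_mult_def mat_def if_distrib[of "\<lambda>x. x * _"] sum.delta' cong: if_cong)

lemma mat_mult_commute: "A ** mat c = mat c ** (A :: complex^'n^'n)"
  by (simp add: vec_eq_iff mat_mult_nth)
    (simp add: matrix_matrix_mult_def mat_def if_distrib[of "\<lambda>x. _ * x"] sum.delta mult.commute cong: if_cong)

lemma mat_mult_mat: "mat c ** (mat d ** A) = mat (c * d) ** A"
  by (simp add: vec_eq_iff mat_mult_nth mult.assoc)

lemma mat_mult_left_commute:
  "A ** (mat c ** B) = mat c ** (A ** (B :: complex^'p^'n))" for A :: "complex^'n^'n"
  by (simp add: matrix_mul_assoc mat_mult_commute)

text \<open>Columns of a unitary matrix are unit vectors, so all entries have modulus at most 1. The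
  value of the bound is crude; what matters is that it is uniform over all unitary matrices, hence
  over all controls and times.\<close>

lemma unitary_norm_bound:
  obtains B where "B > 0" "\<And>U :: complex^'n^'n. ctranspose U ** U = mat 1 \<Longrightarrow> norm U \<le> B"
proof -
  have "norm U \<le> real CARD('n) * real CARD('n)" if U: "ctranspose U ** U = mat 1" for U :: "complex^'n^'n"
  proof -
    have e: "norm (U $ k $ i) \<le> 1" for k i
    proof -
      have "(ctranspose U ** U) $ i $ i = 1" by (simp add: U mat_def)
      then have "(\<Sum>k\<in>UNIV. complex_of_real ((norm (U $ k $ i))\<^sup>2)) = 1"
        by (simp add: matrix_matrix_mult_def ctranspose_nth complex_norm_square mult.commute del: of_real_power)
      then have "(\<Sum>k\<in>UNIV. (norm (U $ k $ i))\<^sup>2) = 1"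
        by (metis of_real_eq_1_iff of_real_sum)
      then have "(norm (U $ k $ i))\<^sup>2 \<le> 1"
        using member_le_sum[of k UNIV "\<lambda>k. (norm (U $ k $ i))\<^sup>2"] by simp
      then show ?thesis by (simp add: power_le_one_iff abs_square_le_1)
    qed
    have "norm U \<le> (\<Sum>k\<in>UNIV. norm (U $ k))"
      by (simp add: norm_vec_def L2_set_le_sum)
    also have "\<dots> \<le> (\<Sum>k\<in>(UNIV::'n set). real CARD('n))"
    proof (rule sum_mono)
      fix k
      have "norm (U $ k) \<le> (\<Sum>i\<in>UNIV. norm (U $ k $ i))"
        by (simp add: norm_vec_def[of "U $ k"] L2_set_le_sum)
      also have "\<dots> \<le> (\<Sum>i\<in>(UNIV::'n set). 1)" by (intro sum_mono e)
      finally show "norm (U $ k) \<le> real CARD('n)" by simp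
    qed
    finally show ?thesis by simp
  qed
  then show ?thesis by (intro that[of "real CARD('n) * real CARD('n)"]) auto
qed

lemma AE_lebesgue_on_iff_negligible:
  assumes "S \<in> sets lebesgue"
  shows "(AE t in lebesgue_on S. P t) \<longleftrightarrow> (\<exists>N. negligible N \<and> (\<forall>t \<in> S - N. P t))"
proof -
  have "(AE t in lebesgue_on S. P t) \<longleftrightarrow> (AE t in lebesgue. t \<in> S \<longrightarrow> P t)"
    using assms by (intro AE_restrict_space_iff) simp
  also have "\<dots> \<longleftrightarrow> (\<exists>N. negligible N \<and> (\<forall>t \<in> S - N. P t))"
    by (auto simp: eventually_ae_filter negligible_iff_null_sets)
  finally show ?thesis .
qed

text \<open>\<open>mat (-\<i>)\<close> inverts \<open>mat \<i>\<close>, so the existentially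
  quantified derivative is determined; the almost everywhere clause becomes an explicit negligible
  set.\<close>

lemma is_evolution_iff:
  "is_evolution H0 V T f U \<longleftrightarrow> abs_cont_on {0..T} U \<and> U 0 = mat 1 \<and>
     (\<exists>N. negligible N \<and> (\<forall>t\<in>{0..T} - N.
        (U has_vector_derivative mat (-\<i>) ** ((H0 + f t *\<^sub>R V) ** U t)) (at t within {0..T})))"
proof -
  have "(\<exists>D. (U has_vector_derivative D) F \<and> mat \<i> ** D = X) \<longleftrightarrow> (U has_vector_derivative mat (-\<i>) ** X) F" for F X
  proof -
    have "mat \<i> ** D = X \<longleftrightarrow> D = mat (-\<i>) ** X" for D
      by (auto simp: mat_mult_mat)
    then show ?thesis by simp
  qed
  then show ?thesis
    unfolding is_evolution_def by (simp add: AE_lebesgue_on_iff_negligible)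
qed

text \<open>
  Uniqueness, unitarity, continuity and the first variation in the control are all read off
  from this identity.
\<close>
theorem evolution_duhamel:
  assumes H0: "ctranspose H0 = H0" and V: "ctranspose V = (V :: complex^'n^'n)"
    and U: "is_evolution H0 V T f U" and W: "is_evolution H0 V T g W" and t: "t \<in> {0..T}"
  shows "((\<lambda>s. (g s - f s) *\<^sub>R (mat (-\<i>) ** (ctranspose (U s) ** V ** W s)))
           has_integral (ctranspose (U t) ** W t - mat 1)) {0..t}"
proof -
  interpret m: bounded_bilinear "(**) :: complex^'n^'n \<Rightarrow> complex^'n^'n \<Rightarrow> complex^'n^'n"
    by (rule bounded_bilinear_matrix_matrix_mult)
  obtain N1 where N1: "negligible N1" "\<And>t. t\<in>{0..T} - N1 \<Longrightarrow>
        (U has_vector_derivative mat (-\<i>) ** ((H0 + f t *\<^sub>R V) ** U t)) (at t within {0..T})"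
    using U unfolding is_evolution_iff by blast
  obtain N2 where N2: "negligible N2" "\<And>t. t\<in>{0..T} - N2 \<Longrightarrow>
        (W has_vector_derivative mat (-\<i>) ** ((H0 + g t *\<^sub>R V) ** W t)) (at t within {0..T})"
    using W unfolding is_evolution_iff by blast
  have bb: "bounded_bilinear (\<lambda>A B. ctranspose A ** B)"
    by (rule bounded_bilinear.comp1[OF bounded_bilinear_matrix_matrix_mult bounded_linear_ctranspose])
  have sub: "{0..t} \<subseteq> {0..T}" using t by auto
  have "((\<lambda>s. ctranspose (U s) ** (mat (-\<i>) ** ((H0 + g s *\<^sub>R V) ** W s))
       + ctranspose (mat (-\<i>) ** ((H0 + f s *\<^sub>R V) ** U s)) ** W s)
       has_integral (ctranspose (U t) ** W t - ctranspose (U 0) ** W 0)) {0..t}"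
  proof (rule abs_cont_on_bilinear_has_integral[OF bb _ _ _ negligible_Un[OF N1(1) N2(1)]])
    show "abs_cont_on {0..t} U" "abs_cont_on {0..t} W"
      using U W abs_cont_on_subset[OF _ sub] unfolding is_evolution_def by blast+
    fix s assume "s \<in> {0..t} - (N1 \<union> N2)"
    then show "(U has_vector_derivative mat (-\<i>) ** ((H0 + f s *\<^sub>R V) ** U s)) (at s within {0..t})"
       "(W has_vector_derivative mat (-\<i>) ** ((H0 + g s *\<^sub>R V) ** W s)) (at s within {0..t})"
      using sub by (auto intro!: has_vector_derivative_within_subset[OF _ sub] N1(2) N2(2))
  qed (use t in auto)
  \<comment> \<open>As \<open>H0\<close> and \<open>V\<close> are Hermitian, the two terms are -i
    U^dagger (H0 + gV) W and i U^dagger (H0 + fV) W. The drift cancels and only the difference of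
    the controls survives.\<close>
  moreover have "ctranspose (U s) ** (mat (-\<i>) ** ((H0 + g s *\<^sub>R V) ** W s))
       + ctranspose (mat (-\<i>) ** ((H0 + f s *\<^sub>R V) ** U s)) ** W s
       = (g s - f s) *\<^sub>R (mat (-\<i>) ** (ctranspose (U s) ** V ** W s))" for s
  proof -
    have 1: "ctranspose (U s) ** (mat (-\<i>) ** ((H0 + g s *\<^sub>R V) ** W s))
       = mat (-\<i>) ** (ctranspose (U s) ** (H0 + g s *\<^sub>R V) ** W s)"
      by (simp only: mat_mult_left_commute matrix_mul_assoc[symmetric])
    have 2: "ctranspose (mat (-\<i>) ** ((H0 + f s *\<^sub>R V) ** U s)) ** W s
       = mat \<i> ** (ctranspose (U s) ** (H0 + f s *\<^sub>R V) ** W s)"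
      by (simp add: ctranspose_mult ctranspose_mat ctranspose_add ctranspose_scaleR H0 V mat_mult_commute
          matrix_mul_assoc)
    have 3: "ctranspose (U s) ** (H0 + r *\<^sub>R V) ** W s
       = ctranspose (U s) ** H0 ** W s + r *\<^sub>R (ctranspose (U s) ** V ** W s)" for r
      by (simp add: m.add_left m.add_right m.scaleR_left m.scaleR_right)
    show ?thesis unfolding 1 2 3
      by (simp add: vec_eq_iff mat_mult_nth scaleR_conv_of_real[where 'a=complex] algebra_simps)
  qed
  moreover have "ctranspose (U 0) ** W 0 = mat 1"
    using U W by (simp add: is_evolution_def ctranspose_mat)
  ultimately show ?thesis by simp
qed

text \<open>Comparing a solution with itself makes the Duhamel integrand vanish, so U^dagger U keeps
  its initial value.\<close>

lemma is_evolution_unitary: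
  assumes "ctranspose H0 = H0" "ctranspose V = V" "is_evolution H0 V T f U" "t \<in> {0..T}"
  shows "ctranspose (U t) ** U t = mat 1" "U t ** ctranspose (U t) = mat 1"
proof -
  show "ctranspose (U t) ** U t = mat 1"
    using evolution_duhamel[OF assms(1-3,3,4)] has_integral_0_eq by fastforce
  then show "U t ** ctranspose (U t) = mat 1" using matrix_left_right_inverse by blast
qed

lemma is_evolution_diff:
  assumes "ctranspose H0 = H0" "ctranspose V = V" "is_evolution H0 V T f U" "is_evolution H0 V T g W" "t \<in> {0..T}"
  shows "W t - U t = U t ** integral {0..t} (\<lambda>s. (g s - f s) *\<^sub>R (mat (-\<i>) ** (ctranspose (U s) ** V ** W s)))"
  unfolding integral_unique[OF evolution_duhamel[OF assms]]
  using is_evolution_unitary(2)[OF assms(1-3,5)]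
  by (simp add: bounded_bilinear.diff_right[OF bounded_bilinear_matrix_matrix_mult] matrix_mul_assoc)

text \<open>Two solutions for the same control have zero Duhamel integrand, so the definite
  description picks out the value of any solution at hand.\<close>

lemma evolution_eq:
  assumes "ctranspose H0 = H0" "ctranspose V = V" "is_evolution H0 V T f U" "t \<in> {0..T}"
  shows "evolution H0 V T f t = U t"
  unfolding evolution_def
proof (rule the_equality)
  fix X assume "\<exists>W. is_evolution H0 V T f W \<and> W t = X"
  then obtain W where W: "is_evolution H0 V T f W" "W t = X" by blast
  show "X = U t"
    using is_evolution_diff[OF assms(1-3) W(1) assms(4)] W(2)
    by (simp add: bounded_bilinear.zero_right[OF bounded_bilinear_matrix_matrix_mult])
qed (use assms in blast)

section \<open>The space of controls and its seminorm\<close>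

lemma integrable_lebesgue_on_iff_absolutely_integrable_on:
  fixes f :: "'a::euclidean_space \<Rightarrow> 'b::euclidean_space"
  assumes "S \<in> sets lebesgue"
  shows "integrable (lebesgue_on S) f \<longleftrightarrow> f absolutely_integrable_on S"
  using assms by (simp add: integrable_restrict_space set_integrable_def)

lemma L2_controls_absolutely_integrable:
  assumes "f \<in> L2_controls T"
  shows "f absolutely_integrable_on {0..T}" "(\<lambda>t. (f t)\<^sup>2) absolutely_integrable_on {0..T}"
proof -
  have f: "f \<in> borel_measurable (lebesgue_on {0..T})" "integrable (lebesgue_on {0..T}) (\<lambda>t. (f t)\<^sup>2)"
    using assms by (auto simp: L2_controls_def)
  then show f2: "(\<lambda>t. (f t)\<^sup>2) absolutely_integrable_on {0..T}"
    by (simp add: integrable_lebesgue_on_iff_absolutely_integrable_on)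
  have 1: "(\<lambda>t. 1 + (f t)\<^sup>2) integrable_on {0..T}"
    using f2 by (intro integrable_add) (auto simp: absolutely_integrable_on_def)
  have *: "\<bar>x\<bar> \<le> 1 + x\<^sup>2" for x :: real
  proof -
    have "0 \<le> (\<bar>x\<bar> - 1)\<^sup>2 + x\<^sup>2 + 1" by (auto intro!: add_nonneg_nonneg)
    then show ?thesis by (simp add: power2_eq_square algebra_simps)
  qed
  show "f absolutely_integrable_on {0..T}"
    by (rule measurable_bounded_by_integrable_imp_absolutely_integrable[OF f(1) _ 1]) (auto simp: *)
qed

lemma L2_norm_square:
  assumes "f \<in> L2_controls T"
  shows "integral {0..T} (\<lambda>t. (f t)\<^sup>2) = (L2_norm T f)\<^sup>2"
proof -
  have "integral\<^sup>L (lebesgue_on {0..T}) (\<lambda>t. (f t)\<^sup>2) = integral {0..T} (\<lambda>t. (f t)\<^sup>2)"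
    using assms by (intro lebesgue_integral_eq_integral) (auto simp: L2_controls_def)
  then show ?thesis
    unfolding L2_norm_def using integral_nonneg[of "\<lambda>t. (f t)\<^sup>2" "{0..T}"]
      L2_controls_absolutely_integrable(2)[OF assms] by (simp add: absolutely_integrable_on_def)
qed

text \<open>Integrates |x| \<le> d + x^2 / d in place of using Cauchy-Schwarz: the two terms
  contribute d T and at most d. Only smallness with d matters later.\<close>

lemma L1_bound_by_L2_norm:
  assumes f: "f \<in> L2_controls T" and T: "T \<ge> 0" and d: "d > 0" and le: "L2_norm T f \<le> d"
  shows "integral {0..T} (\<lambda>t. \<bar>f t\<bar>) \<le> d * (T + 1)"
proof -
  have f1: "(\<lambda>t. \<bar>f t\<bar>) integrable_on {0..T}" and f2: "(\<lambda>t. (f t)\<^sup>2) integrable_on {0..T}"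
    using L2_controls_absolutely_integrable[OF f] by (auto simp: absolutely_integrable_on_def)
  have i: "(\<lambda>t. (f t)\<^sup>2 * (1 / d)) integrable_on {0..T}" by (rule integrable_on_mult_left[OF f2])
  have *: "\<bar>x\<bar> \<le> d + x\<^sup>2 * (1 / d)" for x :: real
  proof -
    have "0 \<le> (\<bar>x\<bar> - d)\<^sup>2 + d * \<bar>x\<bar>" using d by simp
    then show ?thesis using d by (simp add: power2_eq_square field_simps)
  qed
  have "integral {0..T} (\<lambda>t. \<bar>f t\<bar>) \<le> integral {0..T} (\<lambda>t. d + (f t)\<^sup>2 * (1 / d))"
    by (intro integral_le f1 integrable_add i *) auto
  also have "\<dots> = T * d + (L2_norm T f)\<^sup>2 / d"
    using T L2_norm_square[OF f] by (subst integral_add[OF integrable_const_ivl i]) simp_all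
  also have "(L2_norm T f)\<^sup>2 / d \<le> d\<^sup>2 / d"
    using le d by (intro divide_right_mono power_mono) (auto simp: L2_norm_def)
  finally show ?thesis using d by (simp add: power2_eq_square algebra_simps)
qed

lemma L2_controls_add:
  assumes f: "f \<in> L2_controls T" and g: "g \<in> L2_controls T"
  shows "(\<lambda>t. f t + g t) \<in> L2_controls T"
  unfolding L2_controls_def
proof (intro CollectI conjI)
  show m: "(\<lambda>t. f t + g t) \<in> borel_measurable (lebesgue_on {0..T})"
    using f g by (auto simp: L2_controls_def)
  have "integrable (lebesgue_on {0..T}) (\<lambda>t. 2 * (f t)\<^sup>2 + 2 * (g t)\<^sup>2)"
    using f g by (auto simp: L2_controls_def)
  then show "integrable (lebesgue_on {0..T}) (\<lambda>t. (f t + g t)\<^sup>2)"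
  proof (rule Bochner_Integration.integrable_bound)
    have "(x + y)\<^sup>2 \<le> 2 * x\<^sup>2 + 2 * y\<^sup>2" for x y :: real
      using zero_le_power2[of "x - y"] by (simp add: power2_eq_square algebra_simps)
    then show "AE t in lebesgue_on {0..T}. norm ((f t + g t)\<^sup>2) \<le> norm (2 * (f t)\<^sup>2 + 2 * (g t)\<^sup>2)"
      by (intro AE_I2) simp
  qed (use m in measurable)
qed

lemma L2_controls_cmult:
  assumes f: "f \<in> L2_controls T"
  shows "(\<lambda>t. c * f t) \<in> L2_controls T"
  using f by (auto simp: L2_controls_def power_mult_distrib)

lemma L2_controls_diff:
  assumes f: "f \<in> L2_controls T" and g: "g \<in> L2_controls T"
  shows "(\<lambda>t. f t - g t) \<in> L2_controls T"
  using L2_controls_add[OF f L2_controls_cmult[OF g, of "-1"]] by simp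

lemma L2_controls_continuous:
  assumes "continuous_on {0..T} k"
  shows "k \<in> L2_controls T"
  unfolding L2_controls_def using assms
  by (auto intro!: continuous_imp_measurable_on_sets_lebesgue continuous_imp_integrable_real continuous_intros)

lemma L2_norm_cmult: "L2_norm T (\<lambda>t. c * f t) = \<bar>c\<bar> * L2_norm T f"
  by (simp add: L2_norm_def power_mult_distrib real_sqrt_mult)

section \<open>Existence of solutions and their dependence on the control\<close>

lemma is_evolution_exists:
  assumes f: "f \<in> L2_controls T" and T: "T \<ge> 0"
  obtains U where "is_evolution H0 V T f U"
proof -
  have "(\<lambda>t. f t *\<^sub>R (mat (-\<i>) ** V)) absolutely_integrable_on {0..T}"
    using absolutely_integrable_linear[OF L2_controls_absolutely_integrable(1)[OF f]
        bounded_linear_scaleR_left[of "mat (-\<i>) ** V"]] by (simp add: o_def)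
  moreover have "(\<lambda>t. mat (-\<i>) ** H0) absolutely_integrable_on {0..T}" by simp
  ultimately have A: "(\<lambda>t. mat (-\<i>) ** H0 + f t *\<^sub>R (mat (-\<i>) ** V)) absolutely_integrable_on {0..T}"
    by (intro set_integral_add)
  obtain U where U: "abs_cont_on {0..T} U" "U 0 = mat 1" "\<exists>N. negligible N \<and> (\<forall>t \<in> {0..T} - N.
      (U has_vector_derivative (mat (-\<i>) ** H0 + f t *\<^sub>R (mat (-\<i>) ** V)) ** U t) (at t within {0..T}))"
    using linear_ode_exists[OF bounded_bilinear_matrix_matrix_mult T A] by blast
  have "mat (-\<i>) ** H0 + f t *\<^sub>R (mat (-\<i>) ** V) = mat (-\<i>) ** (H0 + f t *\<^sub>R V)" for t
    by (simp add: vec_eq_iff mat_mult_nth scaleR_conv_of_real[where 'a=complex] algebra_simps)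
  then have "is_evolution H0 V T f U"
    unfolding is_evolution_iff using U by (simp add: matrix_mul_assoc)
  then show ?thesis by (rule that)
qed

lemma bounded_bilinear_sandwich:
  "bounded_bilinear (\<lambda>(X :: complex^'n^'n) (Y :: complex^'n^'n). mat c ** (ctranspose X ** V ** Y))"
proof -
  have "bounded_linear (\<lambda>X. mat c ** (ctranspose X ** V))"
    by (intro bounded_linear_compose[OF bounded_bilinear.bounded_linear_right[OF bounded_bilinear_matrix_matrix_mult]]
       bounded_linear_compose[OF bounded_bilinear.bounded_linear_left[OF bounded_bilinear_matrix_matrix_mult]]
       bounded_linear_ctranspose)
  from bounded_bilinear.comp1[OF bounded_bilinear_matrix_matrix_mult this]
  show ?thesis by (simp add: matrix_mul_assoc)
qed

text \<open>Both solutions in the Duhamel formula are unitary, so its integrand is at most a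
  constant times |g - f| and no Gronwall argument is needed. The constant is obtained before T, the
  controls and the time are fixed: it combines the bound \<open>B\<close> on unitary matrices with
  the norms \<open>Q\<close> and \<open>K\<close> of the bilinear maps involved.\<close>

lemma is_evolution_dist:
  assumes H0: "ctranspose H0 = H0" and V: "ctranspose V = (V :: complex^'n^'n)"
  obtains C where "C > 0"
    "\<And>T f g U W t. is_evolution H0 V T f U \<Longrightarrow> is_evolution H0 V T g W \<Longrightarrow> f \<in> L2_controls T \<Longrightarrow> g \<in> L2_controls T \<Longrightarrow>
        t \<in> {0..T} \<Longrightarrow> norm (W t - U t) \<le> C * integral {0..T} (\<lambda>s. \<bar>g s - f s\<bar>)"
proof -
  obtain B where B: "B > 0" "\<And>U :: complex^'n^'n. ctranspose U ** U = mat 1 \<Longrightarrow> norm U \<le> B"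
    using unitary_norm_bound by blast
  obtain K where K: "K > 0" "\<And>(X :: complex^'n^'n) (Y :: complex^'n^'n). norm (X ** Y) \<le> norm X * norm Y * K"
    using bounded_bilinear.pos_bounded[OF bounded_bilinear_matrix_matrix_mult] by blast
  obtain Q where Q: "Q > 0" "\<And>(X :: complex^'n^'n) (Y :: complex^'n^'n). norm (mat (-\<i>) ** (ctranspose X ** V ** Y)) \<le> norm X * norm Y * Q"
    using bounded_bilinear.pos_bounded[OF bounded_bilinear_sandwich] by blast
  show ?thesis
  proof (rule that)
    show "B * (B * B * Q) * K > 0" using B K Q by simp
    fix T f g U W t
    assume U: "is_evolution H0 V T f U" and W: "is_evolution H0 V T g W" and f: "f \<in> L2_controls T"
      and g: "g \<in> L2_controls T" and t: "t \<in> {0..T}"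
    define R where "R = (\<lambda>s. (g s - f s) *\<^sub>R (mat (-\<i>) ** (ctranspose (U s) ** V ** W s)))"
    have Ub: "norm (U s) \<le> B" and Wb: "norm (W s) \<le> B" if "s \<in> {0..T}" for s
      using B(2) is_evolution_unitary(1)[OF H0 V U that] is_evolution_unitary(1)[OF H0 V W that] by auto
    have i: "(\<lambda>s. \<bar>g s - f s\<bar>) integrable_on {0..T}"
      using L2_controls_absolutely_integrable(1)[OF L2_controls_diff[OF g f]] by (auto simp: absolutely_integrable_on_def)
    have it: "(\<lambda>s. \<bar>g s - f s\<bar>) integrable_on {0..t}"
      using integrable_on_subinterval[OF i, of 0 t] t by auto
    have "norm (integral {0..t} R) \<le> integral {0..t} (\<lambda>s. \<bar>g s - f s\<bar> * (B * B * Q))"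
    proof (rule integral_norm_bound_integral)
      show "R integrable_on {0..t}" unfolding R_def using evolution_duhamel[OF H0 V U W t] by blast
      show "(\<lambda>s. \<bar>g s - f s\<bar> * (B * B * Q)) integrable_on {0..t}" by (rule integrable_on_mult_left[OF it])
      fix s assume "s \<in> {0..t}"
      then have s: "s \<in> {0..T}" using t by auto
      have "norm (U s) * norm (W s) * Q \<le> B * B * Q"
        using Ub[OF s] Wb[OF s] B Q by (intro mult_mono) auto
      then have "norm (mat (-\<i>) ** (ctranspose (U s) ** V ** W s)) \<le> B * B * Q"
        using Q(2)[of "U s" "W s"] by linarith
      then show "norm (R s) \<le> \<bar>g s - f s\<bar> * (B * B * Q)"
        unfolding R_def by (simp add: mult_left_mono)
    qed
    also have "\<dots> = (B * B * Q) * integral {0..t} (\<lambda>s. \<bar>g s - f s\<bar>)" by (simp add: mult.commute)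
    also have "\<dots> \<le> (B * B * Q) * integral {0..T} (\<lambda>s. \<bar>g s - f s\<bar>)"
      using t B Q by (intro mult_left_mono integral_subset_le i it) auto
    finally have R: "norm (integral {0..t} R) \<le> (B * B * Q) * integral {0..T} (\<lambda>s. \<bar>g s - f s\<bar>)" .
    have "norm (W t - U t) \<le> norm (U t) * norm (integral {0..t} R) * K"
      unfolding is_evolution_diff[OF H0 V U W t] R_def by (rule K)
    also have "\<dots> \<le> B * ((B * B * Q) * integral {0..T} (\<lambda>s. \<bar>g s - f s\<bar>)) * K"
      using Ub[OF t] R B K by (intro mult_right_mono mult_mono) auto
    finally show "norm (W t - U t) \<le> B * (B * B * Q) * K * integral {0..T} (\<lambda>s. \<bar>g s - f s\<bar>)"
      by (simp add: mult_ac)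
  qed
qed

text \<open>Replacing the perturbed solution by \<open>U\<close> in the Duhamel integrand gives the
  linear term. The replacement error is O(s) by Lipschitz dependence and carries a further factor s
  from the control, so the remainder is O(s^2). Directions \<open>k\<close> are continuous, which
  makes all integrands continuous; the gradient direction used later is of this kind.\<close>

lemma evolution_first_variation:
  assumes H0: "ctranspose H0 = H0" and V: "ctranspose V = (V :: complex^'n^'n)"
    and T: "T \<ge> 0" and f: "f \<in> L2_controls T" and k: "continuous_on {0..T} k"
    and U: "is_evolution H0 V T f U"
  shows "((\<lambda>s. evolution H0 V T (\<lambda>t. f t + s * k t) T) has_vector_derivative
     U T ** integral {0..T} (\<lambda>t. k t *\<^sub>R (mat (-\<i>) ** (ctranspose (U t) ** V ** U t)))) (at 0)"
proof -
  define q where "q = (\<lambda>(X :: complex^'n^'n) (Y :: complex^'n^'n). mat (-\<i>) ** (ctranspose X ** V ** Y))"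
  interpret q: bounded_bilinear q unfolding q_def by (rule bounded_bilinear_sandwich)
  interpret m: bounded_bilinear "(**) :: complex^'n^'n \<Rightarrow> complex^'n^'n \<Rightarrow> complex^'n^'n"
    by (rule bounded_bilinear_matrix_matrix_mult)
  have TT: "T \<in> {0..T}" using T by simp
  have g: "(\<lambda>t. f t + s * k t) \<in> L2_controls T" for s
    by (intro L2_controls_add f L2_controls_cmult L2_controls_continuous k)
  have "\<forall>s. \<exists>W. is_evolution H0 V T (\<lambda>t. f t + s * k t) W"
    using is_evolution_exists[OF g T] by blast
  then obtain W where W: "\<And>s. is_evolution H0 V T (\<lambda>t. f t + s * k t) (W s)" by metis
  have ev: "evolution H0 V T (\<lambda>t. f t + s * k t) T = W s T" for s
    by (rule evolution_eq[OF H0 V W TT])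
  have W0: "W 0 T = U T"
    using evolution_eq[OF H0 V U TT] ev[of 0] by simp
  have Uc: "continuous_on {0..T} U" and Wc: "continuous_on {0..T} (W s)" for s
    using U W[of s] abs_cont_on_imp_continuous_on unfolding is_evolution_def by blast+
  define D where "D = U T ** integral {0..T} (\<lambda>t. k t *\<^sub>R q (U t) (U t))"
  \<comment> \<open>The error of freezing the second argument at \<open>U\<close>; its integral is
    the whole remainder of the expansion.\<close>
  define R where "R = (\<lambda>s t. (s * k t) *\<^sub>R q (U t) (W s t - U t))"
  have ik: "(\<lambda>t. k t *\<^sub>R q (U t) (U t)) integrable_on {0..T}"
    by (intro integrable_continuous_interval continuous_intros q.continuous_on k Uc)
  have iR: "R s integrable_on {0..T}" for s
    unfolding R_def by (intro integrable_continuous_interval continuous_intros q.continuous_on k Uc Wc)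
  have rem: "W s T - W 0 T - s *\<^sub>R D = U T ** integral {0..T} (R s)" for s
  proof -
    have "W s T - U T = U T ** integral {0..T} (\<lambda>t. (s * k t) *\<^sub>R q (U t) (W s t))"
      using is_evolution_diff[OF H0 V U W TT, of s] by (simp add: q_def)
    also have "integral {0..T} (\<lambda>t. (s * k t) *\<^sub>R q (U t) (W s t))
        = integral {0..T} (\<lambda>t. R s t + s *\<^sub>R (k t *\<^sub>R q (U t) (U t)))"
      by (rule integral_cong) (simp add: R_def q.diff_right algebra_simps)
    also have "\<dots> = integral {0..T} (R s) + s *\<^sub>R integral {0..T} (\<lambda>t. k t *\<^sub>R q (U t) (U t))"
      by (simp only: integral_add[OF iR integrable_cmul[OF ik]] integral_cmul)
    finally show ?thesis
      unfolding D_def W0 by (simp add: m.add_right m.scaleR_right)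
  qed
  obtain C where C: "C > 0" "\<And>T f g U W t. is_evolution H0 V T f U \<Longrightarrow> is_evolution H0 V T g W \<Longrightarrow>
      f \<in> L2_controls T \<Longrightarrow> g \<in> L2_controls T \<Longrightarrow> t \<in> {0..T} \<Longrightarrow>
      norm (W t - U t) \<le> C * integral {0..T} (\<lambda>s. \<bar>g s - f s\<bar>)"
    using is_evolution_dist[OF H0 V] by blast
  define I where "I = integral {0..T} (\<lambda>t. \<bar>k t\<bar>)"
  have C': "norm (W s t - U t) \<le> C * (\<bar>s\<bar> * I)" if "t \<in> {0..T}" for s t
    using C(2)[OF U W f g that, of s] by (simp add: I_def abs_mult)
  have I0: "I \<ge> 0" unfolding I_def
    by (intro integral_nonneg integrable_continuous_interval continuous_intros k) auto
  have "bounded (k ` {0..T})" "bounded (U ` {0..T})"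
    using k Uc by (simp_all add: compact_imp_bounded compact_continuous_image)
  then obtain M B where M: "M > 0" "\<And>t. t \<in> {0..T} \<Longrightarrow> \<bar>k t\<bar> \<le> M"
     and B: "B > 0" "\<And>t. t \<in> {0..T} \<Longrightarrow> norm (U t) \<le> B"
    unfolding bounded_pos by fastforce
  obtain Q where Q: "Q > 0" "\<And>X Y. norm (q X Y) \<le> norm X * norm Y * Q"
    using q.pos_bounded by blast
  obtain K where K: "K > 0" "\<And>(X :: complex^'n^'n) (Y :: complex^'n^'n). norm (X ** Y) \<le> norm X * norm Y * K"
    using m.pos_bounded by blast
  define E where "E = B * (M * (B * (C * I) * Q) * T) * K"
  have E0: "E \<ge> 0" unfolding E_def using B M C I0 Q T K by simp
  have est: "norm (W s T - W 0 T - s *\<^sub>R D) \<le> E * s\<^sup>2" for s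
  proof -
    have "norm (integral {0..T} (R s)) \<le> integral {0..T} (\<lambda>t. s\<^sup>2 * (M * (B * (C * I) * Q)))"
    proof (rule integral_norm_bound_integral[OF iR])
      fix t assume t: "t \<in> {0..T}"
      have "norm (q (U t) (W s t - U t)) \<le> B * (C * (\<bar>s\<bar> * I)) * Q"
        using B(2)[OF t] C'[OF t] B Q
        by (intro order_trans[OF Q(2)] mult_right_mono mult_mono) auto
      then have "norm (R s t) \<le> (\<bar>s\<bar> * M) * (B * (C * (\<bar>s\<bar> * I)) * Q)"
        unfolding R_def using M(2)[OF t] M(1) by (simp add: abs_mult) (intro mult_mono; simp)
      then show "norm (R s t) \<le> s\<^sup>2 * (M * (B * (C * I) * Q))"
        by (simp add: power2_eq_square mult_ac flip: abs_mult)
    qed (rule integrable_const_ivl)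
    also have "\<dots> = s\<^sup>2 * (M * (B * (C * I) * Q) * T)" using T by simp
    finally have r: "norm (integral {0..T} (R s)) \<le> s\<^sup>2 * (M * (B * (C * I) * Q) * T)" .
    have "norm (U T ** integral {0..T} (R s)) \<le> norm (U T) * norm (integral {0..T} (R s)) * K"
      by (rule K)
    also have "\<dots> \<le> B * (s\<^sup>2 * (M * (B * (C * I) * Q) * T)) * K"
      using r B(2)[OF TT] B K by (intro mult_right_mono mult_mono) auto
    finally show ?thesis unfolding rem E_def by (simp add: mult_ac)
  qed
  have "((\<lambda>s. W s T) has_vector_derivative D) (at 0)"
    unfolding has_vector_derivative_def has_derivative_at_alt
  proof (intro conjI allI impI bounded_linear_scaleR_left)
    fix e :: real assume e: "e > 0"
    have "norm (W s T - W 0 T - s *\<^sub>R D) \<le> e * \<bar>s\<bar>" if "\<bar>s\<bar> < e / (E + 1)" for s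
    proof -
      have "E * \<bar>s\<bar> \<le> (E + 1) * \<bar>s\<bar>" by (simp add: mult_right_mono)
      also have "\<dots> \<le> e" using that E0 by (simp add: field_simps)
      finally have "E * \<bar>s\<bar> * \<bar>s\<bar> \<le> e * \<bar>s\<bar>" by (rule mult_right_mono) simp
      then show ?thesis using est[of s] by (simp add: power2_eq_square mult.assoc flip: abs_mult)
    qed
    then show "\<exists>d>0. \<forall>s. norm (s - 0) < d \<longrightarrow> norm (W s T - W 0 T - (s - 0) *\<^sub>R D) \<le> e * norm (s - 0)"
      using e E0 by (intro exI[of _ "e / (E + 1)"]) auto
  qed
  then show ?thesis unfolding ev D_def q_def .
qed

text \<open>Heisenberg equation: the derivative of U^dagger X U is U^dagger i[H0 + fV, X] U. Drift
  and control parts are kept apart because one of them vanishes in each application: the control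
  part for X = V, the drift part for X commuting with \<open>H0\<close>.\<close>

theorem evolution_heisenberg:
  assumes H0: "ctranspose H0 = H0" and V: "ctranspose V = (V :: complex^'n^'n)"
    and U: "is_evolution H0 V T f U" and t: "t \<in> {0..T}"
  shows "((\<lambda>s. ctranspose (U s) ** (mat \<i> ** (H0 ** X - X ** H0) + f s *\<^sub>R (mat \<i> ** (V ** X - X ** V))) ** U s)
           has_integral (ctranspose (U t) ** X ** U t - X)) {0..t}"
proof -
  interpret m: bounded_bilinear "(**) :: complex^'n^'n \<Rightarrow> complex^'n^'n \<Rightarrow> complex^'n^'n"
    by (rule bounded_bilinear_matrix_matrix_mult)
  obtain N where N: "negligible N" "\<And>t. t\<in>{0..T} - N \<Longrightarrow>
        (U has_vector_derivative mat (-\<i>) ** ((H0 + f t *\<^sub>R V) ** U t)) (at t within {0..T})"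
    using U unfolding is_evolution_iff by blast
  have bb: "bounded_bilinear (\<lambda>(A :: complex^'n^'n) (B :: complex^'n^'n). ctranspose A ** X ** B)"
    by (rule bounded_bilinear.comp1[OF bounded_bilinear_matrix_matrix_mult
          bounded_linear_compose[OF m.bounded_linear_left[of X] bounded_linear_ctranspose]])
  have sub: "{0..t} \<subseteq> {0..T}" using t by auto
  have ac: "abs_cont_on {0..t} U"
    using U abs_cont_on_subset[OF _ sub] unfolding is_evolution_def by blast
  have "((\<lambda>s. ctranspose (U s) ** X ** (mat (-\<i>) ** ((H0 + f s *\<^sub>R V) ** U s))
       + ctranspose (mat (-\<i>) ** ((H0 + f s *\<^sub>R V) ** U s)) ** X ** U s)
       has_integral (ctranspose (U t) ** X ** U t - ctranspose (U 0) ** X ** U 0)) {0..t}"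
  proof (rule abs_cont_on_bilinear_has_integral[OF bb _ ac ac N(1)])
    fix s assume "s \<in> {0..t} - N"
    then show "(U has_vector_derivative mat (-\<i>) ** ((H0 + f s *\<^sub>R V) ** U s)) (at s within {0..t})"
      using sub by (auto intro!: has_vector_derivative_within_subset[OF _ sub] N(2))
    then show "(U has_vector_derivative mat (-\<i>) ** ((H0 + f s *\<^sub>R V) ** U s)) (at s within {0..t})" .
  qed (use t in auto)
  moreover have "ctranspose (U s) ** X ** (mat (-\<i>) ** ((H0 + f s *\<^sub>R V) ** U s))
       + ctranspose (mat (-\<i>) ** ((H0 + f s *\<^sub>R V) ** U s)) ** X ** U s
       = ctranspose (U s) ** (mat \<i> ** (H0 ** X - X ** H0) + f s *\<^sub>R (mat \<i> ** (V ** X - X ** V))) ** U s" for s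
  proof -
    define Y where "Y = ctranspose (U s)"
    have 1: "Y ** X ** (mat (-\<i>) ** ((H0 + f s *\<^sub>R V) ** U s))
       = mat (-\<i>) ** (Y ** (X ** (H0 + f s *\<^sub>R V)) ** U s)"
      by (simp only: mat_mult_left_commute matrix_mul_assoc[symmetric])
    have 2: "ctranspose (mat (-\<i>) ** ((H0 + f s *\<^sub>R V) ** U s)) ** X ** U s
       = mat \<i> ** (Y ** ((H0 + f s *\<^sub>R V) ** X) ** U s)"
      unfolding Y_def
      by (simp add: ctranspose_mult ctranspose_mat ctranspose_add ctranspose_scaleR H0 V mat_mult_commute
          matrix_mul_assoc)
    have 3: "Y ** (mat \<i> ** (H0 ** X - X ** H0) + f s *\<^sub>R (mat \<i> ** (V ** X - X ** V))) ** U s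
       = mat \<i> ** (Y ** (H0 ** X) ** U s - Y ** (X ** H0) ** U s)
         + f s *\<^sub>R (mat \<i> ** (Y ** (V ** X) ** U s - Y ** (X ** V) ** U s))"
      by (simp add: m.add_left m.add_right m.scaleR_left m.scaleR_right m.diff_left m.diff_right mat_mult_left_commute)
       (simp add: matrix_mul_assoc mat_mult_commute)
    show ?thesis unfolding Y_def[symmetric] 1 2 3
      by (simp add: m.add_left m.add_right m.scaleR_left m.scaleR_right)
        (simp add: vec_eq_iff mat_mult_nth scaleR_conv_of_real[where 'a=complex] algebra_simps)
  qed
  moreover have "ctranspose (U 0) ** X ** U 0 = X"
    using U by (simp add: is_evolution_def ctranspose_mat)
  ultimately show ?thesis by simp
qed

subsection \<open>Kinematics of the \<open>\<Xi>\<close> system\<close>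

lemma diag3_nth [simp]:
  "diag3 a b c $ 1 $ 1 = a" "diag3 a b c $ 1 $ 2 = 0" "diag3 a b c $ 1 $ 3 = 0"
  "diag3 a b c $ 2 $ 1 = 0" "diag3 a b c $ 2 $ 2 = b" "diag3 a b c $ 2 $ 3 = 0"
  "diag3 a b c $ 3 $ 1 = 0" "diag3 a b c $ 3 $ 2 = 0" "diag3 a b c $ 3 $ 3 = c"
  by (simp_all add: diag3_def vector_3)

lemma Xi_V_nth [simp]:
  "Xi_V v $ 1 $ 1 = 0" "Xi_V v $ 1 $ 2 = v" "Xi_V v $ 1 $ 3 = 0"
  "Xi_V v $ 2 $ 1 = cnj v" "Xi_V v $ 2 $ 2 = 0" "Xi_V v $ 2 $ 3 = v"
  "Xi_V v $ 3 $ 1 = 0" "Xi_V v $ 3 $ 2 = cnj v" "Xi_V v $ 3 $ 3 = 0"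
  by (simp_all add: Xi_V_def vector_3)

lemma matrix_mult_3: "(A ** B) $ i $ j = A$i$1 * B$1$j + A$i$2 * B$2$j + A$i$3 * B$3$j"
  for A B :: "complex^3^3"
  by (simp add: matrix_matrix_mult_def sum_3)

lemma hermitian_Xi_H0: "ctranspose (Xi_H0 \<omega>) = Xi_H0 \<omega>"
  by (simp add: vec_eq_iff forall_3 ctranspose_nth Xi_H0_def)

lemma hermitian_Xi_V: "ctranspose (Xi_V v) = Xi_V v"
  by (simp add: vec_eq_iff forall_3 ctranspose_nth)

text \<open>The Gram matrix of psi_2^2 - 2 psi_1 psi_3, the invariant quadratic form of the spin-1
  representation in a weight basis.\<close>

definition spin_form :: "complex^3^3" where
  "spin_form = vector [vector [0, 0, -1], vector [0, 1, 0], vector [-1, 0, 0]]"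

lemma spin_form_nth [simp]:
  "spin_form $ 1 $ 1 = 0" "spin_form $ 1 $ 2 = 0" "spin_form $ 1 $ 3 = -1"
  "spin_form $ 2 $ 1 = 0" "spin_form $ 2 $ 2 = 1" "spin_form $ 2 $ 3 = 0"
  "spin_form $ 3 $ 1 = -1" "spin_form $ 3 $ 2 = 0" "spin_form $ 3 $ 3 = 0"
  by (simp_all add: spin_form_def vector_3)

text \<open>
  The spin-1 representation preserves a symmetric bilinear form; besides unitarity and
  determinant 1, this is all that is used of the structure of the dynamical group.
\<close>
lemma Xi_evolution_spin_form:
  assumes U: "is_evolution (Xi_H0 \<omega>) (Xi_V v) T f U" and t: "t \<in> {0..T}"
  shows "transpose (U t) ** spin_form ** U t = spin_form"
proof -
  let ?H = "\<lambda>s. Xi_H0 \<omega> + f s *\<^sub>R Xi_V v"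
  interpret m: bounded_bilinear "(**) :: complex^3^3 \<Rightarrow> complex^3^3 \<Rightarrow> complex^3^3"
    by (rule bounded_bilinear_matrix_matrix_mult)
  obtain N where N: "negligible N" "\<And>t. t\<in>{0..T} - N \<Longrightarrow>
        (U has_vector_derivative mat (-\<i>) ** (?H t ** U t)) (at t within {0..T})"
    using U unfolding is_evolution_iff by blast
  have "bounded_linear (transpose :: complex^3^3 \<Rightarrow> _)"
    unfolding linear_conv_bounded_linear[symmetric]
    by (rule linearI) (simp_all add: vec_eq_iff transpose_def)
  then have bb: "bounded_bilinear (\<lambda>(A :: complex^3^3) (B :: complex^3^3). transpose A ** spin_form ** B)"
    by (rule bounded_bilinear.comp1[OF bounded_bilinear_matrix_matrix_mult
          bounded_linear_compose[OF m.bounded_linear_left[of spin_form]]])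
  have sub: "{0..t} \<subseteq> {0..T}" using t by auto
  have ac: "abs_cont_on {0..t} U"
    using U abs_cont_on_subset[OF _ sub] unfolding is_evolution_def by blast
  have "((\<lambda>s. transpose (U s) ** spin_form ** (mat (-\<i>) ** (?H s ** U s))
       + transpose (mat (-\<i>) ** (?H s ** U s)) ** spin_form ** U s)
       has_integral (transpose (U t) ** spin_form ** U t - transpose (U 0) ** spin_form ** U 0)) {0..t}"
  proof (rule abs_cont_on_bilinear_has_integral[OF bb _ ac ac N(1)])
    fix s assume "s \<in> {0..t} - N"
    then show "(U has_vector_derivative mat (-\<i>) ** (?H s ** U s)) (at s within {0..t})"
      using sub by (auto intro!: has_vector_derivative_within_subset[OF _ sub] N(2))
    then show "(U has_vector_derivative mat (-\<i>) ** (?H s ** U s)) (at s within {0..t})" .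
  qed (use t in auto)
  moreover have "transpose (U s) ** spin_form ** (mat (-\<i>) ** (?H s ** U s))
       + transpose (mat (-\<i>) ** (?H s ** U s)) ** spin_form ** U s = 0" for s
  proof -
    have 1: "transpose (U s) ** spin_form ** (mat (-\<i>) ** (?H s ** U s))
       = mat (-\<i>) ** (transpose (U s) ** (spin_form ** ?H s) ** U s)"
      by (simp only: mat_mult_left_commute matrix_mul_assoc[symmetric])
    have 2: "transpose (mat (-\<i>) ** (?H s ** U s)) ** spin_form ** U s
       = mat (-\<i>) ** (transpose (U s) ** (transpose (?H s) ** spin_form) ** U s)"
      by (simp add: matrix_transpose_mul mat_mult_commute matrix_mul_assoc)
    \<comment> \<open>Infinitesimal invariance: S H is antisymmetric. This is where the equal
      couplings and the opposite outer energies of the harmonic system are used.\<close>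
    have 3: "transpose (?H s) ** spin_form = - (spin_form ** ?H s)"
      by (simp add: vec_eq_iff forall_3 matrix_mult_3 transpose_def Xi_H0_def)
    show ?thesis unfolding 1 2 3 by (simp add: m.minus_left m.minus_right)
  qed
  moreover have "transpose (U 0) ** spin_form ** U 0 = spin_form"
    using U by (simp add: is_evolution_def)
  ultimately show ?thesis using has_integral_0_eq by fastforce
qed

text \<open>The (3,3) entry of the form is 0, so the third column is isotropic and |psi_2|^2 = 2
  |psi_1| |psi_3|. Normalisation then becomes (|psi_1| + |psi_3|)^2 = 1, leaving one free
  modulus.\<close>

lemma spin_unitary_populations:
  fixes M :: "complex^3^3"
  assumes u: "ctranspose M ** M = mat 1" and s: "transpose M ** spin_form ** M = spin_form"
  shows "cmod (M$3$3) \<le> 1" "cmod (M$1$3) = 1 - cmod (M$3$3)"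
    "(cmod (M$2$3))\<^sup>2 = 2 * cmod (M$3$3) * (1 - cmod (M$3$3))"
proof -
  have "(transpose M ** spin_form ** M) $ 3 $ 3 = 0" by (simp add: s)
  then have "(M$2$3)\<^sup>2 = 2 * M$1$3 * M$3$3"
    by (simp add: matrix_mult_3 transpose_def power2_eq_square algebra_simps)
  then have "cmod ((M$2$3)\<^sup>2) = cmod (2 * M$1$3 * M$3$3)" by simp
  then have q: "(cmod (M$2$3))\<^sup>2 = 2 * cmod (M$1$3) * cmod (M$3$3)"
    by (simp add: norm_power norm_mult)
  have "(ctranspose M ** M) $ 3 $ 3 = 1" by (simp add: u mat_def)
  then have "complex_of_real ((cmod (M$1$3))\<^sup>2 + (cmod (M$2$3))\<^sup>2 + (cmod (M$3$3))\<^sup>2) = 1"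
    unfolding of_real_add complex_norm_square by (simp add: matrix_mult_3 ctranspose_nth mult.commute)
  then have "(cmod (M$1$3))\<^sup>2 + (cmod (M$2$3))\<^sup>2 + (cmod (M$3$3))\<^sup>2 = 1"
    unfolding of_real_eq_1_iff .
  then have "(cmod (M$1$3) + cmod (M$3$3))\<^sup>2 = 1"
    unfolding q by (simp add: power2_eq_square algebra_simps)
  then have "cmod (M$1$3) + cmod (M$3$3) = 1"
    using power2_eq_1_iff[of "cmod (M$1$3) + cmod (M$3$3)"] norm_ge_zero[of "M$1$3"] norm_ge_zero[of "M$3$3"] by linarith
  then show e: "cmod (M$1$3) = 1 - cmod (M$3$3)" by simp
  show "cmod (M$3$3) \<le> 1" using e norm_ge_zero[of "M$1$3"] by linarith
  show "(cmod (M$2$3))\<^sup>2 = 2 * cmod (M$3$3) * (1 - cmod (M$3$3))" using q e by (simp add: mult_ac)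
qed

text \<open>If the corner entry has modulus 1, unit rows and columns clear the rest of row and
  column 3. The (1,3) entry of the form makes the other corner its inverse, also of modulus 1, which
  clears row and column 1; the determinant then fixes the middle entry.\<close>

lemma spin_unitary_in_R_Z_iff:
  fixes M :: "complex^3^3"
  assumes u: "ctranspose M ** M = mat 1" and s: "transpose M ** spin_form ** M = spin_form" and d: "det M = 1"
  shows "M \<in> R_Z \<longleftrightarrow> cmod (M$3$3) = 1"
proof
  assume "M \<in> R_Z"
  then show "cmod (M$3$3) = 1" by (auto simp: R_Z_def norm_exp_i_times)
next
  assume 1: "cmod (M$3$3) = 1"
  have u': "M ** ctranspose M = mat 1" using u matrix_left_right_inverse by blast
  have row: "(cmod (M$i$1))\<^sup>2 + (cmod (M$i$2))\<^sup>2 + (cmod (M$i$3))\<^sup>2 = 1" for i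
  proof -
    have "(M ** ctranspose M) $ i $ i = 1" by (simp add: u' mat_def)
    then have "complex_of_real ((cmod (M$i$1))\<^sup>2 + (cmod (M$i$2))\<^sup>2 + (cmod (M$i$3))\<^sup>2) = 1"
      unfolding of_real_add complex_norm_square by (simp add: matrix_mult_3 ctranspose_nth mult.commute)
    then show ?thesis unfolding of_real_eq_1_iff .
  qed
  have col: "(cmod (M$1$i))\<^sup>2 + (cmod (M$2$i))\<^sup>2 + (cmod (M$3$i))\<^sup>2 = 1" for i
  proof -
    have "(ctranspose M ** M) $ i $ i = 1" by (simp add: u mat_def)
    then have "complex_of_real ((cmod (M$1$i))\<^sup>2 + (cmod (M$2$i))\<^sup>2 + (cmod (M$3$i))\<^sup>2) = 1"
      unfolding of_real_add complex_norm_square by (simp add: matrix_mult_3 ctranspose_nth mult.commute)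
    then show ?thesis unfolding of_real_eq_1_iff .
  qed
  have z3: "M$1$3 = 0" "M$2$3 = 0" "M$3$1 = 0" "M$3$2 = 0"
    using col[of 3] row[of 3] 1 by (simp_all add: sum_power2_eq_zero_iff)
  have "(transpose M ** spin_form ** M) $ 1 $ 3 = -1" by (simp add: s)
  then have inv: "M$1$1 * M$3$3 = 1"
    by (simp add: matrix_mult_3 transpose_def z3)
  then have "cmod (M$1$1) = 1" using 1 by (metis mult.right_neutral norm_mult norm_one)
  then have z1: "M$1$2 = 0" "M$2$1 = 0"
    using col[of 1] row[of 1] z3 by (simp_all add: sum_power2_eq_zero_iff)
  have "M$1$1 * M$2$2 * M$3$3 = 1" using d by (simp add: det_3 z1 z3)
  then have "M$2$2 * (M$1$1 * M$3$3) = 1" by (simp add: mult_ac)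
  then have m2: "M$2$2 = 1" unfolding inv by simp
  obtain \<phi> where \<phi>: "\<phi> \<in> {-pi..<pi}" "M$3$3 = exp (\<i> * of_real \<phi>)"
  \<comment> \<open>\<open>Arg\<close> takes values in the interval open at -pi and closed at pi,
    while \<open>R_Z\<close> uses the opposite convention, so the value pi is replaced by
    -pi.\<close>
  proof (cases "Arg (M$3$3) = pi")
    case True
    then have "M$3$3 = exp (\<i> * of_real pi)" using Arg_eq[of "M$3$3"] 1 by force
    then have "M$3$3 = exp (\<i> * of_real (-pi))" by (simp add: exp_minus)
    then show ?thesis using that[of "-pi"] by auto
  next
    case False
    then show ?thesis
      using that[of "Arg (M$3$3)"] Arg_eq[of "M$3$3"] mpi_less_Arg[of "M$3$3"] Arg_le_pi[of "M$3$3"] 1 by fastforce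
  qed
  have "M$1$1 = exp (- \<i> * of_real \<phi>)"
    using inv \<phi>(2) by (simp add: exp_minus inverse_unique mult.commute)
  then have "M = diag3 (exp (- \<i> * of_real \<phi>)) 1 (exp (\<i> * of_real \<phi>))"
    using \<phi>(2) by (simp add: vec_eq_iff forall_3 z1 z3 m2)
  then show "M \<in> R_Z" using \<phi>(1) unfolding R_Z_def by blast
qed

section \<open>A group element that empties the third level\<close>

lemma mat_exp_nth:
  fixes A :: "complex^'n^'n"
  shows "(\<lambda>k. (1 / fact k) *\<^sub>R ((((\<lambda>B. A ** B) ^^ k) (mat 1)) $ i $ j)) sums (mat_exp A $ i $ j)"
proof -
  obtain K where K: "K > 0" "\<And>(X :: complex^'n^'n) (Y :: complex^'n^'n). norm (X ** Y) \<le> norm X * norm Y * K"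
    using bounded_bilinear.pos_bounded[OF bounded_bilinear_matrix_matrix_mult] by blast
  let ?P = "\<lambda>k. ((\<lambda>B. A ** B) ^^ k) (mat 1)"
  have P: "norm (?P k) \<le> (norm A * K) ^ k * norm (mat 1 :: complex^'n^'n)" for k
  proof (induction k)
    case (Suc k)
    have "norm (?P (Suc k)) \<le> (norm A * K) * norm (?P k)"
      using K(2)[of A "?P k"] by (simp add: mult_ac)
    also have "\<dots> \<le> (norm A * K) * ((norm A * K) ^ k * norm (mat 1 :: complex^'n^'n))"
      using K by (intro mult_left_mono Suc) auto
    finally show ?case by (simp add: mult.assoc)
  qed simp
  have "summable (\<lambda>k. (1 / fact k) *\<^sub>R ?P k)"
  proof (rule summable_comparison_test'[of _ 0])
    show "summable (\<lambda>k. (norm A * K) ^ k /\<^sub>R fact k * norm (mat 1 :: complex^'n^'n))"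
      by (intro summable_mult2 summable_exp_generic)
    show "norm ((1 / fact k) *\<^sub>R ?P k) \<le> (norm A * K) ^ k /\<^sub>R fact k * norm (mat 1 :: complex^'n^'n)" for k
      using P[of k] by (simp add: divide_inverse mult.assoc mult_left_mono)
  qed
  then have "(\<lambda>k. (1 / fact k) *\<^sub>R ?P k) sums mat_exp A"
    unfolding mat_exp_def by (rule summable_sums)
  then have "(\<lambda>k. ((1 / fact k) *\<^sub>R ?P k) $ i $ j) sums (mat_exp A $ i $ j)"
    by (intro bounded_linear.sums[OF bounded_linear_compose[OF bounded_linear_vec_nth bounded_linear_vec_nth]])
  then show ?thesis by simp
qed

text \<open>The entry equals (1 + cos(sqrt 2 |v| t)) / 2: half of the third basis vector, in squared
  length, lies in the kernel of V, and the other half oscillates with the nonzero eigenvalues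
  \<plusminus>sqrt 2 |v|. The chosen t makes the cosine -1.\<close>

lemma mat_exp_Xi_V_nth_33:
  assumes v: "v \<noteq> 0"
  obtains t :: real where "mat_exp (t *\<^sub>R (mat \<i> ** Xi_V v)) $ 3 $ 3 = 0"
proof -
  define t where "t = pi / (sqrt 2 * cmod v)"
  define A where "A = t *\<^sub>R (mat \<i> ** Xi_V v)"
  let ?P = "\<lambda>k. ((\<lambda>B. A ** B) ^^ k) (mat 1)"
  have t: "2 * t\<^sup>2 * (cmod v)\<^sup>2 = pi\<^sup>2"
    using v by (simp add: t_def power_divide power_mult_distrib)
  have t': "2 * (complex_of_real t)\<^sup>2 * (v * cnj v) = (complex_of_real pi)\<^sup>2"
    by (metis (no_types) t complex_norm_square of_real_mult of_real_numeral of_real_power)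
  have A_nth: "A $ i $ j = \<i> * of_real t * Xi_V v $ i $ j" for i j
    by (simp add: A_def mat_mult_nth scaleR_conv_of_real[where 'a=complex] mult_ac)
  \<comment> \<open>A^2 maps the second basis vector to -2 t^2 |v|^2 = -pi^2 times itself. Odd
    powers of A send the third basis vector to multiples of the second, so they follow a scalar
    recursion.\<close>
  have sq: "(A ** (A ** Q)) $ 1 $ 3 = 0 \<and> (A ** (A ** Q)) $ 2 $ 3 = - (of_real pi)\<^sup>2 * Q $ 2 $ 3 \<and> (A ** (A ** Q)) $ 3 $ 3 = 0"
    if "Q $ 1 $ 3 = 0" "Q $ 3 $ 3 = 0" for Q :: "complex^3^3"
    unfolding t'[symmetric] using that by (simp add: matrix_mult_3 A_nth power2_eq_square algebra_simps)
  have P13: "?P (Suc (2*n)) $ 1 $ 3 = 0 \<and> ?P (Suc (2*n)) $ 2 $ 3 = (-1)^n * of_real pi^(2*n) * (\<i> * of_real t * v) \<and> ?P (Suc (2*n)) $ 3 $ 3 = 0" for n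
  proof (induction n)
    case 0
    show ?case by (simp add: A_nth)
  next
    case (Suc n)
    have "?P (Suc (2 * Suc n)) = A ** (A ** ?P (Suc (2*n)))" by simp
    with sq[of "?P (Suc (2*n))"] Suc show ?case
      by (simp only:) (simp add: power2_eq_square)
  qed
  \<comment> \<open>The extra 1/2 at k = 0 is the kernel component; the rest is half the cosine
    series at pi, written with \<open>cos_coeff\<close> so that odd powers vanish
    automatically.\<close>
  have P33: "?P k $ 3 $ 3 = (if k = 0 then 1 / 2 else 0) + of_real (fact k * cos_coeff k * pi ^ k / 2)" for k
  proof (cases "even k")
    case True
    show ?thesis
    proof (cases "k = 0")
      case False
      with True obtain n where k: "k = Suc (Suc (2 * n))"
        by (metis evenE mult_Suc_right nat.exhaust numeral_2_eq_2 plus_nat.simps(1,2) mult_0_right)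
      \<comment> \<open>A positive even power is one step past an odd one, whose third column is
        already known.\<close>
      have "?P k = A ** ?P (Suc (2 * n))" by (simp add: k)
      then have "?P k $ 3 $ 3 = \<i> * of_real t * cnj v * ((-1)^n * of_real pi^(2*n) * (\<i> * of_real t * v))"
        using P13[of n] by (simp only: matrix_mult_3 A_nth) simp
      also have "\<dots> = (-1)^n * of_real pi^(2*n) * (- (of_real pi)\<^sup>2 / 2)"
        unfolding t'[symmetric] by (simp add: power2_eq_square algebra_simps)
      also have "\<dots> = of_real ((-1) ^ Suc n * pi ^ k / 2)"
        by (simp add: k power2_eq_square)
      also have "(-1) ^ Suc n = fact k * cos_coeff k"
        using True by (simp add: cos_coeff_def k del: fact_Suc)
      finally show ?thesis using False by simp
    qed (simp add: mat_def)
  next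
    case False
    then obtain n where "k = Suc (2 * n)" by (metis oddE Suc_eq_plus1)
    then show ?thesis using P13[of n] by (simp add: cos_coeff_def)
  qed
  have "(\<lambda>k. cos_coeff k *\<^sub>R pi ^ k * (1 / 2)) sums (cos pi * (1 / 2))"
    by (rule sums_mult2[OF cos_converges])
  then have "(\<lambda>k. complex_of_real (cos_coeff k * pi ^ k / 2)) sums (of_real (- 1 / 2))"
    by (subst sums_of_real_iff) simp
  moreover have "(\<lambda>k. if k = 0 then 1 / 2 else 0 :: complex) sums (1 / 2)"
    using sums_single[of 0 "\<lambda>_. 1 / 2 :: complex"] by simp
  ultimately have "(\<lambda>k. (if k = 0 then 1 / 2 else 0) + complex_of_real (cos_coeff k * pi ^ k / 2)) sums 0"
    using sums_add by fastforce
  moreover have "(1 / fact k) *\<^sub>R (?P k $ 3 $ 3) = (if k = 0 then 1 / 2 else 0) + complex_of_real (cos_coeff k * pi ^ k / 2)" for k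
    unfolding P33 by (auto simp: scaleR_conv_of_real field_simps)
  ultimately have "mat_exp A $ 3 $ 3 = 0"
    using sums_unique2[OF mat_exp_nth[of A 3 3]] by simp
  then show ?thesis unfolding A_def by (rule that)
qed

subsection \<open>The control landscape\<close>

definition level :: "real \<Rightarrow> real \<Rightarrow> real \<Rightarrow> real \<Rightarrow> real" where
  "level l1 l2 l3 x = l1 * (1 - x)\<^sup>2 + l2 * (2 * x * (1 - x)) + l3 * x\<^sup>2"

text \<open>Exact expansion around x. When \<open>l2\<close> is the smallest value the curvature is
  positive, so any move that does not decrease the linear term strictly increases the level.\<close>

lemma level_diff:
  "level l1 l2 l3 y - level l1 l2 l3 x =
    (y - x) * (2 * (l2 - l1) + 2 * (l1 - 2 * l2 + l3) * x) + (l1 - 2 * l2 + l3) * (y - x)\<^sup>2"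
  unfolding level_def by algebra

lemma level_le_left:
  assumes "l2 < l1" "l2 < l3" "0 \<le> x" "x \<le> 1" "l3 < l1"
  shows "level l1 l2 l3 x \<le> level l1 l2 l3 0"
proof -
  have "level l1 l2 l3 0 - level l1 l2 l3 x = 2 * x * (1 - x) * (l1 - l2) + x\<^sup>2 * (l1 - l3)"
    by (simp add: level_def power2_eq_square algebra_simps)
  also have "\<dots> \<ge> 0" using assms by (intro add_nonneg_nonneg mult_nonneg_nonneg) auto
  finally show ?thesis by simp
qed

text \<open>The second assumption keeps x on the near side of the other point where the quadratic
  takes its value at 1. It gives the endpoint maximum an explicit basin, stated without
  division.\<close>

lemma level_le_right:
  assumes "x \<le> 1" "(1 - x) * (l1 - 2 * l2 + l3) \<le> 2 * (l3 - l2)"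
  shows "level l1 l2 l3 x \<le> level l1 l2 l3 1"
proof -
  have "level l1 l2 l3 1 - level l1 l2 l3 x = (1 - x) * (2 * (l3 - l2) - (1 - x) * (l1 - 2 * l2 + l3))"
    by (simp add: level_def power2_eq_square algebra_simps)
  also have "\<dots> \<ge> 0" using assms by (intro mult_nonneg_nonneg) auto
  finally show ?thesis by simp
qed

text \<open>Derivatives within a nondegenerate closed interval are unique also at its endpoints; the
  endpoint t = T is the one needed later.\<close>

lemma integral_eq_0_imp_eq_0:
  fixes g :: "real \<Rightarrow> real"
  assumes T: "T > 0" and g: "continuous_on {0..T} g"
    and 0: "\<And>t. t \<in> {0..T} \<Longrightarrow> integral {0..t} g = 0" and t: "t \<in> {0..T}"
  shows "g t = 0"
proof (rule vector_derivative_unique_within_closed_interval[where f = "\<lambda>_. 0 :: real"])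
  show "t \<in> cbox 0 T" "0 < T" using t T by auto
  show "((\<lambda>_. 0 :: real) has_vector_derivative 0) (at t within cbox 0 T)" by simp
  show "((\<lambda>_. 0) has_vector_derivative g t) (at t within cbox 0 T)"
    using has_vector_derivative_transform[OF t _ integral_has_vector_derivative[OF g t], of "\<lambda>_. 0"] 0 by simp
qed

section \<open>Critical controls and local maxima of the objective\<close>

locale Xi_system =
  fixes \<omega> :: real and v :: complex
  assumes \<omega>: "\<omega> \<noteq> 0" and v: "v \<noteq> 0"
begin

abbreviation evol where "evol T f \<equiv> evolution (Xi_H0 \<omega>) (Xi_V v) T f T"
abbreviation is_evol where "is_evol \<equiv> is_evolution (Xi_H0 \<omega>) (Xi_V v)"

lemma is_evol_exists:
  assumes "f \<in> L2_controls T" "T \<ge> 0"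
  obtains U where "is_evol T f U" "evol T f = U T"
  using is_evolution_exists[OF assms] evolution_eq[OF hermitian_Xi_H0 hermitian_Xi_V] assms(2)
  by (metis atLeastAtMost_iff order_refl)

lemma evol_unitary:
  assumes "f \<in> L2_controls T" "T \<ge> 0"
  shows "ctranspose (evol T f) ** evol T f = mat 1"
    "transpose (evol T f) ** spin_form ** evol T f = spin_form"
proof -
  obtain U where U: "is_evol T f U" "evol T f = U T" using is_evol_exists[OF assms] by blast
  have "T \<in> {0..T}" using assms by simp
  then show "ctranspose (evol T f) ** evol T f = mat 1"
    "transpose (evol T f) ** spin_form ** evol T f = spin_form"
    unfolding U(2) using is_evolution_unitary(1)[OF hermitian_Xi_H0 hermitian_Xi_V U(1)] Xi_evolution_spin_form[OF U(1)]
    by blast+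
qed

text \<open>The initial state projects onto the third basis vector, so only the third column of the
  endpoint enters, and the observable weights its three populations.\<close>

lemma objective_eq_level:
  assumes "f \<in> L2_controls T" "T \<ge> 0"
  shows "objective (Xi_H0 \<omega>) (Xi_V v) (diag3 0 0 1) (diag3 (of_real l1) (of_real l2) (of_real l3)) T f
    = level l1 l2 l3 (cmod (evol T f $ 3 $ 3))"
proof -
  define M where "M = evol T f"
  note p = spin_unitary_populations[OF evol_unitary[OF assms], folded M_def]
  have "objective (Xi_H0 \<omega>) (Xi_V v) (diag3 0 0 1) (diag3 (of_real l1) (of_real l2) (of_real l3)) T f
    = Re (M$1$3 * cnj (M$1$3) * of_real l1 + M$2$3 * cnj (M$2$3) * of_real l2 + M$3$3 * cnj (M$3$3) * of_real l3)"
    unfolding objective_def M_def[symmetric] trace_def sum_3 matrix_mult_3 by (simp add: ctranspose_nth)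
  also have "\<dots> = l1 * (cmod (M$1$3))\<^sup>2 + l2 * (cmod (M$2$3))\<^sup>2 + l3 * (cmod (M$3$3))\<^sup>2"
    unfolding complex_norm_square[symmetric] by (simp flip: of_real_mult of_real_power)
  finally show ?thesis unfolding level_def p(2,3) M_def[symmetric] by (simp add: mult_ac)
qed

text \<open>The initial state commutes with \<open>H0\<close>, and the zero control removes the V
  term, so the Heisenberg equation leaves this projection constant.\<close>

lemma evol_zero:
  assumes "T \<ge> 0"
  shows "cmod (evol T (\<lambda>_. 0) $ 3 $ 3) = 1"
proof -
  have z: "(\<lambda>_. 0) \<in> L2_controls T" by (rule L2_controls_continuous) simp
  obtain U where U: "is_evol T (\<lambda>_. 0) U" "evol T (\<lambda>_. 0) = U T" using is_evol_exists[OF z assms] by blast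
  have TT: "T \<in> {0..T}" using assms by simp
  have c: "Xi_H0 \<omega> ** diag3 0 0 1 - diag3 0 0 1 ** Xi_H0 \<omega> = 0"
    by (simp add: vec_eq_iff forall_3 matrix_mult_3 Xi_H0_def)
  have "((\<lambda>s. 0) has_integral (ctranspose (U T) ** diag3 0 0 1 ** U T - diag3 0 0 1)) {0..T}"
    using evolution_heisenberg[OF hermitian_Xi_H0 hermitian_Xi_V U(1) TT, of "diag3 0 0 1"]
    by (simp add: c)
  then have "ctranspose (U T) ** diag3 0 0 1 ** U T = diag3 0 0 1"
    using has_integral_0_eq by fastforce
  then have "(ctranspose (U T) ** diag3 0 0 1 ** U T) $ 3 $ 3 = 1" by simp
  then have "complex_of_real ((cmod (U T $ 3 $ 3))\<^sup>2) = 1"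
    unfolding complex_norm_square by (simp add: matrix_mult_3 ctranspose_nth mult.commute)
  then have "(cmod (U T $ 3 $ 3))\<^sup>2 = 1" unfolding of_real_eq_1_iff .
  then show ?thesis unfolding U(2) by (simp add: power2_eq_1_iff) (smt (verit) norm_ge_zero)
qed

text \<open>
  \<open>L (U\<^sup>\<dagger> V U)\<close> is half the functional derivative of the survival probability
  at the control. If it vanishes identically then so does its time derivative, in which the control
  drops out; at the final time these two real conditions are the imaginary and real part of one
  complex equation.
\<close>
lemma critical_imp_extreme:
  assumes T: "T > 0" and U: "is_evol T f U"
  defines "L \<equiv> \<lambda>X :: complex^3^3. Re (cnj (U T $ 3 $ 3) * (U T ** (mat (-\<i>) ** X)) $ 3 $ 3)"
  assumes crit: "\<And>t. t \<in> {0..T} \<Longrightarrow> L (ctranspose (U t) ** Xi_V v ** U t) = 0"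
  shows "U T $ 3 $ 3 = 0 \<or> U T $ 2 $ 3 = 0"
proof -
  interpret m: bounded_bilinear "(**) :: complex^3^3 \<Rightarrow> complex^3^3 \<Rightarrow> complex^3^3"
    by (rule bounded_bilinear_matrix_matrix_mult)
  \<comment> \<open>i[H0,V] generates the time derivative of U^dagger V U; the control would
    multiply [V,V] = 0. Its continuous integrand can thus be evaluated at T although f is only
    square integrable.\<close>
  define W where "W = mat \<i> ** (Xi_H0 \<omega> ** Xi_V v - Xi_V v ** Xi_H0 \<omega>)"
  have TT: "T \<in> {0..T}" using T by simp
  have Uc: "continuous_on {0..T} U"
    using U abs_cont_on_imp_continuous_on unfolding is_evolution_def by blast
  have "bounded_linear (\<lambda>X :: complex^3^3. (U T ** (mat (-\<i>) ** X)) $ 3 $ 3)"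
    by (intro bounded_linear_compose[OF bounded_linear_compose[OF bounded_linear_vec_nth bounded_linear_vec_nth]]
        bounded_linear_compose[OF m.bounded_linear_right[of "U T"] m.bounded_linear_right[of "mat (-\<i>)"]])
  then have L: "bounded_linear L"
    unfolding L_def
    by (intro bounded_linear_compose[OF bounded_linear_Re] bounded_linear_compose[OF bounded_linear_mult_right])
  have g: "continuous_on {0..T} (\<lambda>t. L (ctranspose (U t) ** W ** U t))"
    by (intro bounded_linear.continuous_on[OF L] m.continuous_on continuous_on_const Uc
       bounded_linear.continuous_on[OF bounded_linear_ctranspose])
  have "L (ctranspose (U T) ** W ** U T) = 0"
  proof (rule integral_eq_0_imp_eq_0[OF T g _ TT])
    fix t assume t: "t \<in> {0..T}"
    have "((\<lambda>s. ctranspose (U s) ** W ** U s) has_integral (ctranspose (U t) ** Xi_V v ** U t - Xi_V v)) {0..t}"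
      using evolution_heisenberg[OF hermitian_Xi_H0 hermitian_Xi_V U t, of "Xi_V v"]
      by (simp add: W_def m.zero_right)
    from has_integral_linear[OF this L]
    have "integral {0..t} (\<lambda>s. L (ctranspose (U s) ** W ** U s)) = L (ctranspose (U t) ** Xi_V v ** U t) - L (Xi_V v)"
      by (simp add: o_def integral_unique linear_diff bounded_linear.linear[OF L])
    moreover have "L (Xi_V v) = 0"
      using crit[of 0] T U by (simp add: is_evolution_def ctranspose_mat)
    ultimately show "integral {0..t} (\<lambda>s. L (ctranspose (U s) ** W ** U s)) = 0"
      using crit[OF t] by simp
  qed
  \<comment> \<open>At the final time U U^dagger cancels, so only the third row of X is seen. For V
    it is (0, cnj v, 0) and for \<open>W\<close> it is i \<open>\<omega>\<close> times that, which
    turns the two conditions into Im z = 0 and \<open>\<omega>\<close> Re z = 0.\<close>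
  moreover have LT: "L (ctranspose (U T) ** X ** U T) = Re (cnj (U T $ 3 $ 3) * (- \<i> * (X ** U T) $ 3 $ 3))" for X
  proof -
    have "U T ** (mat (-\<i>) ** (ctranspose (U T) ** X ** U T)) = mat (-\<i>) ** (U T ** ctranspose (U T) ** (X ** U T))"
      by (simp only: mat_mult_left_commute matrix_mul_assoc[symmetric])
    also have "U T ** ctranspose (U T) = mat 1"
      by (rule is_evolution_unitary(2)[OF hermitian_Xi_H0 hermitian_Xi_V U TT])
    finally show ?thesis unfolding L_def by (simp add: mat_mult_nth)
  qed
  define z where "z = cnj (U T $ 3 $ 3) * (cnj v * U T $ 2 $ 3)"
  have W3: "W $ 3 $ 1 = 0" "W $ 3 $ 2 = \<i> * of_real \<omega> * cnj v" "W $ 3 $ 3 = 0"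
    unfolding W_def mat_mult_nth by (simp_all add: matrix_mult_3 Xi_H0_def)
  have "L (ctranspose (U T) ** W ** U T) = \<omega> * Re z"
    unfolding LT z_def by (simp add: matrix_mult_3[of W] W3 algebra_simps)
  moreover have "L (ctranspose (U T) ** Xi_V v ** U T) = Im z"
    unfolding LT z_def by (simp add: matrix_mult_3 algebra_simps)
  ultimately have "z = 0" using \<omega> crit[OF TT] by (simp add: complex_eq_iff)
  then show ?thesis using v by (simp add: z_def)
qed

text \<open>The control is moved along \<open>k\<close>, half the gradient of x^2, so x^2 has
  derivative twice the integral of k^2, which is positive. Thus x grows for small s > 0 and shrinks
  for small s < 0, and the slope of the quadratic at x decides which side to take.\<close>

lemma not_local_max_interior:
  assumes T: "T > 0" and f: "f \<in> L2_controls T" and l: "l2 < l1" "l2 < l3"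
    and x: "0 < cmod (evol T f $ 3 $ 3)" "cmod (evol T f $ 3 $ 3) < 1"
  shows "\<not> local_max T (objective (Xi_H0 \<omega>) (Xi_V v) (diag3 0 0 1) (diag3 (of_real l1) (of_real l2) (of_real l3)) T) f"
proof
  interpret m: bounded_bilinear "(**) :: complex^3^3 \<Rightarrow> complex^3^3 \<Rightarrow> complex^3^3"
    by (rule bounded_bilinear_matrix_matrix_mult)
  let ?J = "objective (Xi_H0 \<omega>) (Xi_V v) (diag3 0 0 1) (diag3 (of_real l1) (of_real l2) (of_real l3)) T"
  assume "local_max T ?J f"
  then obtain e where e: "e > 0" "\<And>g. g \<in> L2_controls T \<Longrightarrow> L2_norm T (\<lambda>t. g t - f t) < e \<Longrightarrow> ?J g \<le> ?J f"
    unfolding local_max_def by blast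
  have T0: "T \<ge> 0" and TT: "T \<in> {0..T}" using T by auto
  obtain U where U: "is_evol T f U" "evol T f = U T" using is_evol_exists[OF f T0] by blast
  have Uc: "continuous_on {0..T} U"
    using U abs_cont_on_imp_continuous_on unfolding is_evolution_def by blast
  define G where "G = (\<lambda>t. ctranspose (U t) ** Xi_V v ** U t)"
  define L where "L = (\<lambda>X :: complex^3^3. Re (cnj (U T $ 3 $ 3) * (U T ** (mat (-\<i>) ** X)) $ 3 $ 3))"
  define k where "k = (\<lambda>t. L (G t))"
  have "bounded_linear (\<lambda>X :: complex^3^3. (U T ** (mat (-\<i>) ** X)) $ 3 $ 3)"
    by (intro bounded_linear_compose[OF bounded_linear_compose[OF bounded_linear_vec_nth bounded_linear_vec_nth]]
        bounded_linear_compose[OF m.bounded_linear_right[of "U T"] m.bounded_linear_right[of "mat (-\<i>)"]])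
  then have L: "bounded_linear L"
    unfolding L_def
    by (intro bounded_linear_compose[OF bounded_linear_Re] bounded_linear_compose[OF bounded_linear_mult_right])
  have Gc: "continuous_on {0..T} G" unfolding G_def
    by (intro m.continuous_on continuous_on_const Uc bounded_linear.continuous_on[OF bounded_linear_ctranspose])
  have k: "continuous_on {0..T} k"
    unfolding k_def by (intro bounded_linear.continuous_on[OF L] Gc)
  have "\<exists>t\<in>{0..T}. k t \<noteq> 0"
  proof (rule ccontr)
    assume "\<not> (\<exists>t\<in>{0..T}. k t \<noteq> 0)"
    then have "U T $ 3 $ 3 = 0 \<or> U T $ 2 $ 3 = 0"
      by (intro critical_imp_extreme[OF T U(1)]) (auto simp: k_def G_def L_def)
    moreover have "(cmod (U T $ 2 $ 3))\<^sup>2 = 2 * cmod (U T $ 3 $ 3) * (1 - cmod (U T $ 3 $ 3))"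
      using spin_unitary_populations(3)[OF evol_unitary[OF f T0]] unfolding U(2) .
    ultimately show False using x unfolding U(2) by auto
  qed
  \<comment> \<open>A nonnegative continuous integrand with zero integral would vanish everywhere,
    contradicting that \<open>k\<close> is nonzero somewhere.\<close>
  then have "integral {0..T} (\<lambda>t. (k t)\<^sup>2) \<noteq> 0"
    using integral_eq_0_iff[of 0 T "\<lambda>t. (k t)\<^sup>2"] T k by (auto intro!: continuous_intros)
  moreover have "integral {0..T} (\<lambda>t. (k t)\<^sup>2) \<ge> 0"
    by (intro integral_nonneg integrable_continuous_interval continuous_intros k) auto
  ultimately have pos: "integral {0..T} (\<lambda>t. (k t)\<^sup>2) > 0" by simp
  define \<phi> where "\<phi> = (\<lambda>s. evol T (\<lambda>t. f t + s * k t) $ 3 $ 3)"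
  define I where "I = integral {0..T} (\<lambda>t. k t *\<^sub>R G t)"
  define D where "D = (U T ** (mat (-\<i>) ** I)) $ 3 $ 3"
  have kG: "(\<lambda>t. k t *\<^sub>R G t) integrable_on {0..T}"
    by (intro integrable_continuous_interval continuous_intros k Gc)
  have "integral {0..T} (\<lambda>t. k t *\<^sub>R (mat (-\<i>) ** (ctranspose (U t) ** Xi_V v ** U t))) = mat (-\<i>) ** I"
    unfolding I_def G_def[symmetric] using integral_linear[OF kG m.bounded_linear_right[of "mat (-\<i>)"]]
    by (simp add: o_def G_def m.scaleR_right)
  then have "(\<phi> has_vector_derivative D) (at 0)"
    using bounded_linear.has_vector_derivative[OF bounded_linear_compose[OF bounded_linear_vec_nth bounded_linear_vec_nth]
        evolution_first_variation[OF hermitian_Xi_H0 hermitian_Xi_V T0 f k U(1)], of 3 3]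
    by (simp add: \<phi>_def D_def)
  then have re: "((\<lambda>s. Re (\<phi> s)) has_real_derivative Re D) (at 0)"
    and im: "((\<lambda>s. Im (\<phi> s)) has_real_derivative Im D) (at 0)"
    using bounded_linear.has_vector_derivative[OF bounded_linear_Re] bounded_linear.has_vector_derivative[OF bounded_linear_Im]
    by (auto simp: has_real_derivative_iff_has_vector_derivative)
  have "((\<lambda>s. (Re (\<phi> s))\<^sup>2 + (Im (\<phi> s))\<^sup>2) has_real_derivative 2 * (Re (\<phi> 0) * Re D + Im (\<phi> 0) * Im D)) (at 0)"
    using DERIV_add[OF DERIV_power[OF re, of 2] DERIV_power[OF im, of 2]] by (simp add: algebra_simps)
  moreover have \<phi>0: "\<phi> 0 = U T $ 3 $ 3" using U(2) by (simp add: \<phi>_def)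
  have "L I = integral {0..T} (\<lambda>t. (k t)\<^sup>2)"
    unfolding I_def using integral_linear[OF kG L]
    by (simp add: o_def k_def power2_eq_square linear_cmul[OF bounded_linear.linear[OF L]])
  then have "Re (\<phi> 0) * Re D + Im (\<phi> 0) * Im D = integral {0..T} (\<lambda>t. (k t)\<^sup>2)"
    unfolding \<phi>0 L_def D_def[symmetric] by simp
  ultimately have der: "((\<lambda>s. (cmod (\<phi> s))\<^sup>2) has_real_derivative 2 * integral {0..T} (\<lambda>t. (k t)\<^sup>2)) (at 0)"
    by (simp add: cmod_power2)
  have g: "(\<lambda>t. f t + s * k t) \<in> L2_controls T" for s
    by (intro L2_controls_add f L2_controls_cmult L2_controls_continuous k)
  have near: "level l1 l2 l3 (cmod (\<phi> s)) \<le> level l1 l2 l3 (cmod (\<phi> 0))" if "\<bar>s\<bar> < e / (L2_norm T k + 1)" for s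
  proof -
    have n0: "L2_norm T k \<ge> 0" by (simp add: L2_norm_def)
    have "\<bar>s\<bar> * L2_norm T k \<le> \<bar>s\<bar> * (L2_norm T k + 1)" by (intro mult_left_mono) auto
    also have "\<dots> < e" using that n0 by (simp add: field_simps)
    finally have "L2_norm T (\<lambda>t. (f t + s * k t) - f t) < e" by (simp add: L2_norm_cmult)
    then have "?J (\<lambda>t. f t + s * k t) \<le> ?J f" by (rule e(2)[OF g])
    then show ?thesis
      unfolding objective_eq_level[OF g T0] objective_eq_level[OF f T0] by (simp add: \<phi>_def)
  qed
  have d0: "e / (L2_norm T k + 1) > 0"
    using e(1) by (simp add: L2_norm_def add_nonneg_pos)
  define q where "q = l1 - 2 * l2 + l3"
  define c where "c = 2 * (l2 - l1) + 2 * q * cmod (\<phi> 0)"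
  have q: "q > 0" using l by (simp add: q_def)
  have up: "level l1 l2 l3 y > level l1 l2 l3 (cmod (\<phi> 0))" if "(y - cmod (\<phi> 0)) * c \<ge> 0" "y \<noteq> cmod (\<phi> 0)" for y
  proof -
    have "q * (y - cmod (\<phi> 0))\<^sup>2 > 0" using q that(2) by simp
    then show ?thesis
      using level_diff[of l1 l2 l3 y "cmod (\<phi> 0)"] that(1) unfolding c_def q_def by linarith
  qed
  show False
  proof (cases "c \<ge> 0")
    \<comment> \<open>Slope zero belongs here: either direction would do, because the strictly
      convex term in \<open>up\<close> alone gives the increase.\<close>
    case True
    obtain d where d: "d > 0" "\<And>h. 0 < h \<Longrightarrow> h < d \<Longrightarrow> (cmod (\<phi> 0))\<^sup>2 < (cmod (\<phi> h))\<^sup>2"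
      using DERIV_pos_inc_right[OF der] pos by auto
    obtain h where h: "0 < h" "h < d" "\<bar>h\<bar> < e / (L2_norm T k + 1)"
      using field_lbound_gt_zero[OF d(1) d0] by auto
    have "cmod (\<phi> 0) < cmod (\<phi> h)" using d(2)[OF h(1,2)] by (rule power_less_imp_less_base) simp
    then show False using up[of "cmod (\<phi> h)"] near[OF h(3)] True by simp
  next
    case False
    obtain d where d: "d > 0" "\<And>h. 0 < h \<Longrightarrow> h < d \<Longrightarrow> (cmod (\<phi> (-h)))\<^sup>2 < (cmod (\<phi> 0))\<^sup>2"
      using DERIV_pos_inc_left[OF der] pos by auto
    obtain h where h: "0 < h" "h < d" "\<bar>-h\<bar> < e / (L2_norm T k + 1)"
      using field_lbound_gt_zero[OF d(1) d0] by auto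
    have "cmod (\<phi> (-h)) < cmod (\<phi> 0)" using d(2)[OF h(1,2)] by (rule power_less_imp_less_base) simp
    then show False using up[of "cmod (\<phi> (-h))"] near[OF h(3)] False by (simp add: mult_nonpos_nonpos)
  qed
qed

text \<open>The corner entry depends Lipschitz continuously on the control, so nearby controls keep
  x inside the basin of the endpoint maximum at 1; no derivative at the pole is used.\<close>

lemma local_max_at_pole:
  assumes T: "T \<ge> 0" and f: "f \<in> L2_controls T" and l: "l2 < l1" "l2 < l3"
    and x: "cmod (evol T f $ 3 $ 3) = 1"
  shows "local_max T (objective (Xi_H0 \<omega>) (Xi_V v) (diag3 0 0 1) (diag3 (of_real l1) (of_real l2) (of_real l3)) T) f"
proof -
  let ?J = "objective (Xi_H0 \<omega>) (Xi_V v) (diag3 0 0 1) (diag3 (of_real l1) (of_real l2) (of_real l3)) T"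
  obtain C where C: "C > 0" "\<And>T f g U W t. is_evol T f U \<Longrightarrow> is_evol T g W \<Longrightarrow>
      f \<in> L2_controls T \<Longrightarrow> g \<in> L2_controls T \<Longrightarrow> t \<in> {0..T} \<Longrightarrow>
      norm (W t - U t) \<le> C * integral {0..T} (\<lambda>s. \<bar>g s - f s\<bar>)"
    using is_evolution_dist[OF hermitian_Xi_H0 hermitian_Xi_V] by blast
  define q where "q = l1 - 2 * l2 + l3"
  have q: "q > 0" using l by (simp add: q_def)
  \<comment> \<open>Chosen by running the estimates backwards: L2 distance below e gives L1 distance
    at most e (T+1), hence 1 - x \<le> C e (T+1), and q times this bound is exactly 2 (l3 -
    l2).\<close>
  define e where "e = 2 * (l3 - l2) / (q * (C * (T + 1)))"
  have nz: "q * (C * (T + 1)) \<noteq> 0" using q C(1) T by simp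
  have e: "e > 0" using l q C(1) T by (simp add: e_def)
  have "?J g \<le> ?J f" if g: "g \<in> L2_controls T" and n: "L2_norm T (\<lambda>t. g t - f t) < e" for g
  proof -
    obtain U where U: "is_evol T f U" "evol T f = U T" using is_evol_exists[OF f T] by blast
    obtain W where W: "is_evol T g W" "evol T g = W T" using is_evol_exists[OF g T] by blast
    have "norm (W T - U T) \<le> C * integral {0..T} (\<lambda>s. \<bar>g s - f s\<bar>)"
      using C(2)[OF U(1) W(1) f g] T by simp
    also have "\<dots> \<le> C * (e * (T + 1))"
      using L1_bound_by_L2_norm[OF L2_controls_diff[OF g f] T e] n C(1) by (intro mult_left_mono) auto
    finally have WU: "norm (W T - U T) \<le> C * (e * (T + 1))" .
    have "norm ((W T - U T) $ 3 $ 3) \<le> norm (W T - U T)"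
      by (rule order_trans[OF Finite_Cartesian_Product.norm_nth_le Finite_Cartesian_Product.norm_nth_le])
    then have "1 - cmod (W T $ 3 $ 3) \<le> C * (e * (T + 1))"
      using WU norm_triangle_ineq3[of "W T $ 3 $ 3" "U T $ 3 $ 3"] x unfolding U(2) by simp
    then have "(1 - cmod (W T $ 3 $ 3)) * q \<le> C * (e * (T + 1)) * q"
      using q by (intro mult_right_mono) auto
    also have "\<dots> = e * (q * (C * (T + 1)))" by (simp only: mult_ac)
    also have "\<dots> = 2 * (l3 - l2)" using nz unfolding e_def by (metis nonzero_divide_eq_eq)
    finally have "level l1 l2 l3 (cmod (evol T g $ 3 $ 3)) \<le> level l1 l2 l3 1"
      unfolding W(2)[symmetric] q_def
      by (intro level_le_right) (use spin_unitary_populations(1)[OF evol_unitary[OF g T]] in auto)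
    then show ?thesis unfolding objective_eq_level[OF f T] objective_eq_level[OF g T] x .
  qed
  then show ?thesis unfolding local_max_def using f e by blast
qed

end

section \<open>Classification of the traps\<close>

theorem theorem2:
  fixes \<omega> lam1 lam2 lam3 T\<^sub>0 :: real and v :: complex and R :: "(complex^3^3) set"
  defines "H\<^sub>0 \<equiv> Xi_H0 \<omega>" and "V \<equiv> Xi_V v"
  defines "J \<equiv> objective H\<^sub>0 V (diag3 0 0 1)
                 (diag3 (of_real lam1) (of_real lam2) (of_real lam3))"
  assumes "\<omega> \<noteq> 0" and "v \<noteq> 0"
    and "lam1 > lam3" and "lam3 > lam2"
    and "subgroup R SU" and "closed R" and "connected R"
    and "lie_algebra_of R = lie_generated {mat \<i> ** H\<^sub>0, mat \<i> ** V}"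
    and "T\<^sub>0 > 0"
    and "\<forall>T\<ge>T\<^sub>0. {evolution H\<^sub>0 V T f T | f. f \<in> L2_controls T} = R"
  shows "\<forall>T\<ge>T\<^sub>0. (\<forall>f \<in> L2_controls T. trap T (J T) f \<longleftrightarrow> evolution H\<^sub>0 V T f T \<in> R_Z) \<and>
                 trap T (J T) (\<lambda>_. 0)"
proof (intro allI impI)
  fix T assume T: "T \<ge> T\<^sub>0"
  interpret Xi_system \<omega> v using assms(4,5) by unfold_locales
  have T0: "T > 0" "T \<ge> 0" using T assms(12) by auto
  have R: "{evol T f | f. f \<in> L2_controls T} = R"
    using assms(13) T unfolding H\<^sub>0_def V_def by blast
  have l: "lam2 < lam1" "lam2 < lam3" "lam3 < lam1" using assms(6,7) by auto
  have J: "J T f = level lam1 lam2 lam3 (cmod (evol T f $ 3 $ 3))" if "f \<in> L2_controls T" for f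
    unfolding J_def H\<^sub>0_def V_def by (rule objective_eq_level[OF that T0(2)])
  \<comment> \<open>Determinant one is inherited from R being a subgroup of
    \<open>SU\<close>.\<close>
  have RZ: "evol T f \<in> R_Z \<longleftrightarrow> cmod (evol T f $ 3 $ 3) = 1" if f: "f \<in> L2_controls T" for f
  proof (rule spin_unitary_in_R_Z_iff[OF evol_unitary[OF f T0(2)]])
    have "evol T f \<in> R" using R f by blast
    then show "det (evol T f) = 1" using subgroup.subset[OF assms(8)] by (auto simp: SU_def)
  qed
  have le1: "cmod (evol T f $ 3 $ 3) \<le> 1" if f: "f \<in> L2_controls T" for f
    by (rule spin_unitary_populations(1)[OF evol_unitary[OF f T0(2)]])
  have glob: "global_max T (J T) f" if f: "f \<in> L2_controls T" and "cmod (evol T f $ 3 $ 3) = 0" for f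
    unfolding global_max_def using that level_le_left[OF l(1,2) norm_ge_zero le1 l(3)]
    by (simp add: J)
  obtain t where t: "mat_exp (t *\<^sub>R (mat \<i> ** Xi_V v)) $ 3 $ 3 = 0"
    using mat_exp_Xi_V_nth_33[OF v] by blast
  \<comment> \<open>A generator of the Lie algebra exponentiates into R, and every element of R is
    reached at time T; this produces a control with x = 0.\<close>
  have "mat \<i> ** Xi_V v \<in> lie_algebra_of R"
    unfolding assms(11) lie_generated_def H\<^sub>0_def V_def by (rule hull_inc) simp
  then have "mat_exp (t *\<^sub>R (mat \<i> ** Xi_V v)) \<in> R" by (simp add: lie_algebra_of_def)
  then obtain g where g: "g \<in> L2_controls T" "evol T g $ 3 $ 3 = 0" using R t by force
  have not_glob: "\<not> global_max T (J T) f" if f: "f \<in> L2_controls T" and x: "cmod (evol T f $ 3 $ 3) = 1" for f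
  proof
    assume "global_max T (J T) f"
    then have "J T g \<le> J T f" using g(1) unfolding global_max_def by blast
    \<comment> \<open>At x = 0 the objective is \<open>lam1\<close>, at x = 1 it is
      \<open>lam3\<close>, which is smaller.\<close>
    then show False using l unfolding J[OF f] J[OF g(1)] x g(2) by (simp add: level_def)
  qed
  have trap_iff: "trap T (J T) f \<longleftrightarrow> cmod (evol T f $ 3 $ 3) = 1" if f: "f \<in> L2_controls T" for f
  proof
    assume tr: "trap T (J T) f"
    have "cmod (evol T f $ 3 $ 3) \<noteq> 0" using tr glob[OF f] unfolding trap_def by blast
    moreover have "\<not> (0 < cmod (evol T f $ 3 $ 3) \<and> cmod (evol T f $ 3 $ 3) < 1)"
      using tr not_local_max_interior[OF T0(1) f l(1,2)]
      unfolding trap_def J_def H\<^sub>0_def V_def by blast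
    ultimately show "cmod (evol T f $ 3 $ 3) = 1"
      using le1[OF f] norm_ge_zero[of "evol T f $ 3 $ 3"] by linarith
  next
    assume x: "cmod (evol T f $ 3 $ 3) = 1"
    then show "trap T (J T) f"
      using local_max_at_pole[OF T0(2) f l(1,2) x] not_glob[OF f x]
      unfolding trap_def J_def H\<^sub>0_def V_def by blast
  qed
  have "(\<lambda>_. 0) \<in> L2_controls T" by (rule L2_controls_continuous) simp
  then show "(\<forall>f \<in> L2_controls T. trap T (J T) f \<longleftrightarrow> evolution H\<^sub>0 V T f T \<in> R_Z) \<and> trap T (J T) (\<lambda>_. 0)"
    using trap_iff RZ evol_zero[OF T0(2)] unfolding H\<^sub>0_def V_def by blast
qed

end
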